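(* For all $k,\ell\in\mathbb N$, $$2^{(1-o(1))\frac{k\ell}{2}}<f_{\mathrm{par}}^{S_{\aleph_0}}(k,\ell)\le 2^{2^{(1+o(1))k\ell}},$$ where each $o(1)$ stands for a function of $(k,\ell)$ that tends to $0$ as $k\ell\to\infty$.
   Context: $B=K_{\aleph_0}$ is the countably infinite complete graph, and $S_{\aleph_0}$ is the star with countably infinitely many leaves. Two players, Maker and Breaker, alternately claim previously unclaimed edges of $B$, one edge per move; Maker moves first and the game lasts $\omega$ moves. Given a graph $H$ and $k,\ell,C\in\mathbb N$, let $G_1,\dots,G_k\subseteq B$ be pairwise vertex disjoint graphs, each $G_i$ consisting of $C$ pairwise vertex disjoint copies of $H$. In the partially pattern preserving game $\mathrm{MB}^{H}_{\mathrm{par}}(k,C,\ell)$, Maker wins if there is a copy $K\subseteq B$ of $K_{\aleph_0}$, all of whose edges have been claimed by Maker, such that for each $i\in\{1,\dots,k\}$ the graph $G_i\cap K$ contains at least $\ell$ (pairwise vertex disjoint) copies of $H$; otherwise Breaker wins. Maker having a winning strategy in $\mathrm{MB}^{H}_{\mathrm{par}}(k,C,\ell)$ means that she has one for every such choice of $G_1,\dots,G_k\subseteq B$. $f_{\mathrm{par}}^{H}(k,\ell)$ denotes the minimal integer $a\in\mathbb N$ such that Maker has a winning strategy in $\mathrm{MB}^{H}_{\mathrm{par}}(k,a,\ell)$ if such an integer exists, and $f_{\mathrm{par}}^{H}(k,\ell)=\infty$ otherwise. *)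

theory Defs
  imports "HOL-Library.Extended_Real" "HOL-Library.Disjoint_Sets"
begin

section \<open>Graphs\<close>

text \<open>An undirected simple graph has 2-element sets of vertices as its edges.\<close>

datatype 'a graph = Graph (verts: "'a set") (edges: "'a set set")

definition complete_graph :: "'a set \<Rightarrow> 'a graph" where
  "complete_graph V = Graph V {{u, v} | u v. u \<in> V \<and> v \<in> V \<and> u \<noteq> v}"

definition simple_graph :: "'a graph \<Rightarrow> bool" where
  "simple_graph G \<longleftrightarrow> edges G \<subseteq> edges (complete_graph (verts G))"

definition subgraph :: "'a graph \<Rightarrow> 'a graph \<Rightarrow> bool" where
  "subgraph H G \<longleftrightarrow> simple_graph H \<and> verts H \<subseteq> verts G \<and> edges H \<subseteq> edges G"

definition graph_inter :: "'a graph \<Rightarrow> 'a graph \<Rightarrow> 'a graph" where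
  "graph_inter G H = Graph (verts G \<inter> verts H) (edges G \<inter> edges H)"

definition is_copy :: "'a graph \<Rightarrow> 'b graph \<Rightarrow> bool" where
  "is_copy H G \<longleftrightarrow>
     (\<exists>f. bij_betw f (verts H) (verts G) \<and> edges G = (\<lambda>e. f ` e) ` edges H)"

definition consists_of_copies :: "'a graph \<Rightarrow> nat \<Rightarrow> 'b graph \<Rightarrow> bool" where
  "consists_of_copies H n G \<longleftrightarrow>
     (\<exists>F. (\<forall>j\<in>{1..n}. is_copy H (F j)) \<and>
          disjoint_family_on (\<lambda>j. verts (F j)) {1..n} \<and>
          G = Graph (\<Union>j\<in>{1..n}. verts (F j)) (\<Union>j\<in>{1..n}. edges (F j)))"

definition contains_copies :: "'a graph \<Rightarrow> nat \<Rightarrow> 'b graph \<Rightarrow> bool" where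
  "contains_copies H n G \<longleftrightarrow>
     (\<exists>F. (\<forall>j\<in>{1..n}. is_copy H (F j) \<and> subgraph (F j) G) \<and>
          disjoint_family_on (\<lambda>j. verts (F j)) {1..n})"

abbreviation K_aleph0 :: "nat graph" where
  "K_aleph0 \<equiv> complete_graph UNIV"

definition S_aleph0 :: "nat graph" where
  "S_aleph0 = Graph UNIV {{0, n} | n. n \<noteq> 0}"


section \<open>The Maker-Breaker game\<close>

text \<open>A position is the list of all edges claimed so far, in order; Maker is to move exactly
  when its length is even.\<close>

definition position :: "nat set list \<Rightarrow> bool" where
  "position h \<longleftrightarrow> distinct h \<and> set h \<subseteq> edges K_aleph0"

definition play :: "(nat \<Rightarrow> nat set) \<Rightarrow> bool" where
  "play p \<longleftrightarrow> inj p \<and> range p \<subseteq> edges K_aleph0"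

definition maker_strategy :: "(nat set list \<Rightarrow> nat set) \<Rightarrow> bool" where
  "maker_strategy \<sigma> \<longleftrightarrow>
     (\<forall>h. position h \<and> even (length h) \<longrightarrow> \<sigma> h \<in> edges K_aleph0 - set h)"

definition follows :: "(nat set list \<Rightarrow> nat set) \<Rightarrow> (nat \<Rightarrow> nat set) \<Rightarrow> bool" where
  "follows \<sigma> p \<longleftrightarrow> (\<forall>n. even n \<longrightarrow> p n = \<sigma> (map p [0..<n]))"

definition maker_edges :: "(nat \<Rightarrow> nat set) \<Rightarrow> nat set set" where
  "maker_edges p = p ` {n. even n}"

definition pattern_family :: "'a graph \<Rightarrow> nat \<Rightarrow> nat \<Rightarrow> (nat \<Rightarrow> nat graph) \<Rightarrow> bool" where
  "pattern_family H k C G \<longleftrightarrow>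
     (\<forall>i\<in>{1..k}. subgraph (G i) K_aleph0 \<and> consists_of_copies H C (G i)) \<and>
     disjoint_family_on (\<lambda>i. verts (G i)) {1..k}"

definition maker_wins_par ::
    "'a graph \<Rightarrow> nat \<Rightarrow> nat \<Rightarrow> (nat \<Rightarrow> nat graph) \<Rightarrow> (nat \<Rightarrow> nat set) \<Rightarrow> bool" where
  "maker_wins_par H k l G p \<longleftrightarrow>
     (\<exists>K. subgraph K K_aleph0 \<and> is_copy K_aleph0 K \<and> edges K \<subseteq> maker_edges p \<and>
          (\<forall>i\<in>{1..k}. contains_copies H l (graph_inter (G i) K)))"

text \<open>The strategy may depend on the pattern graphs, which are fixed before the game starts.\<close>

definition maker_has_winning_strategy_par :: "'a graph \<Rightarrow> nat \<Rightarrow> nat \<Rightarrow> nat \<Rightarrow> bool" where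
  "maker_has_winning_strategy_par H k C l \<longleftrightarrow>
     (\<forall>G. pattern_family H k C G \<longrightarrow>
        (\<exists>\<sigma>. maker_strategy \<sigma> \<and>
             (\<forall>p. play p \<and> follows \<sigma> p \<longrightarrow> maker_wins_par H k l G p)))"

definition f_par :: "'a graph \<Rightarrow> nat \<Rightarrow> nat \<Rightarrow> enat" where
  "f_par H k l =
     (if \<exists>a. maker_has_winning_strategy_par H k a l
      then enat (LEAST a. maker_has_winning_strategy_par H k a l) else \<infinity>)"

end

theory Submission
  imports Defs "HOL-Library.Sublist" "HOL-Library.FuncSet" "HOL-Library.Infinite_Set"
begin

text \<open>
Write \<open>n = k * l\<close>. Maker needs \<open>n\<close> star centres, \<open>l\<close> from each pattern graph, that form a clique
together with infinitely many leaves of each of these stars.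

Lower bound: there are at most \<open>C ^ n\<close> candidate sets of centres, and each spans \<open>n choose 2\<close> edges, so
Breaker wins by the Erdos-Selfridge criterion on these cliques whenever \<open>2 * C ^ n < 2 ^ (n choose 2)\<close>.

Upper bound: Maker first builds a clique of \<open>n * m\<close> centres, where \<open>m\<close> is cubic in \<open>n\<close>, arranged in \<open>n\<close>
blocks of size \<open>m\<close>; this costs stars exponential in a polynomial of \<open>n\<close>. Then she keeps inserting
untouched leaves. A leaf is joined to its own centre, then to one centre of every other block, and then
to earlier leaves along a branch of a growing tree, each time to an unblocked option that has been used
least often so far. At a point visited infinitely often, this balancing leaves only as many options
neglected as Breaker can block at once. Hence all but few transversals of the blocks are visited
infinitely often by the leaves of each given centre, a union bound yields one transversal that is visited
infinitely often by the leaves of all its members, and in the tree above this transversal such points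
continue to an infinite branch on which the stars take turns.
\<close>

text \<open>Breaker answers every edge, so no leaf can be forced onto a prescribed set of vertices;
  Maker controls only choices among more options than can be blocked at one vertex. The final
  centres and leaves need not be known at any finite time: they are extracted from the completed
  play by pigeonhole on infinite sets of insertions. For this, leaves of different centres must
  share one tree. A leaf that gets stuck where it is the turn of its kind becomes a new option right
  there, so a place where infinitely many such walks get stuck would acquire enough options after
  all; from then on nothing stops there, its options are fixed, and counts can be compared in the
  limit. The kind whose stop creates an option changes cyclically with the depth, which hands
  infinitely many leaves to every star.

  The cubic \<open>m\<close> comes from the union bound: \<open>n\<close> kinds of leaves, fewer
  than \<open>n\<close> extensions through the blocks, at most \<open>2 * n\<close> neglected
  options at each. Only the clique costs stars: \<open>n * m\<close> has order \<open>n ^ 4\<close>,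
  and the sizes needed are at most exponential in its square, whence the exponent
  \<open>90 * n ^ 8\<close>.\<close>

section \<open>Forcing and strategies\<close>

text \<open>Well-founded rather than bounded in the number of moves: after each of Breaker's infinitely many
  possible replies Maker may need a different number of moves.\<close>

inductive force :: "(nat set list \<Rightarrow> bool) \<Rightarrow> nat set list \<Rightarrow> bool" for P where
  now: "P h \<Longrightarrow> force P h"
| move: "e \<in> edges K_aleph0 - set h \<Longrightarrow>
    (\<And>f. f \<in> edges K_aleph0 - set (h @ [e]) \<Longrightarrow> force P (h @ [e, f])) \<Longrightarrow> force P h"

lemma edge_K_aleph0_iff: "{u, v} \<in> edges K_aleph0 \<longleftrightarrow> u \<noteq> v"
  by (auto simp: complete_graph_def doubleton_eq_iff)

lemma edges_K_aleph0_cases: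
  assumes "e \<in> edges K_aleph0"
  obtains u v where "e = {u, v}" "u \<noteq> v"
  using assms by (auto simp: complete_graph_def)

lemma infinite_edges_K_aleph0: "infinite (edges K_aleph0)"
proof -
  have "inj (\<lambda>m::nat. {0, Suc m})" by (auto simp: inj_def doubleton_eq_iff)
  moreover have "range (\<lambda>m::nat. {0, Suc m}) \<subseteq> edges K_aleph0"
    by (auto simp: edge_K_aleph0_iff)
  ultimately show ?thesis
    using range_inj_infinite infinite_super by blast
qed

lemma ex_unclaimed_edge: "\<exists>e. e \<in> edges K_aleph0 - set h"
  using infinite_edges_K_aleph0 by (metis List.finite_set finite_Diff2 ex_in_conv finite.emptyI)

lemma ex_maker_strategy: "\<exists>\<sigma>. maker_strategy \<sigma>"
  unfolding maker_strategy_def using ex_unclaimed_edge by metis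

lemma force_trans:
  assumes "force P h" "\<And>h'. P h' \<Longrightarrow> force Q h'"
  shows "force Q h"
  using assms(1) by induction (auto intro: assms(2) force.move)

lemma force_strengthen:
  assumes "force P h" "position h" "even (length h)"
  shows "force (\<lambda>h'. P h' \<and> position h' \<and> even (length h') \<and> prefix h h') h"
  using assms
proof induction
  case (now h)
  then show ?case by (intro force.now) auto
next
  case (move e h)
  show ?case
  proof (rule force.move[OF move.hyps(1)])
    fix f assume f: "f \<in> edges K_aleph0 - set (h @ [e])"
    have "position (h @ [e, f])"
      using move f by (auto simp: position_def)
    with move.IH[OF f] move.prems
    have "force (\<lambda>h'. P h' \<and> position h' \<and> even (length h') \<and> prefix (h @ [e, f]) h') (h @ [e, f])"
      by simp
    then show "force (\<lambda>h'. P h' \<and> position h' \<and> even (length h') \<and> prefix h h') (h @ [e, f])"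
      by (elim force_trans) (auto intro!: force.now dest: append_prefixD)
  qed
qed

text \<open>Plans are composed through this rule: the second one may use that the first ended in a
  legal position on Maker's turn and only extended the history.\<close>

lemma force_then:
  assumes "force P h" "position h" "even (length h)"
    "\<And>h'. P h' \<Longrightarrow> position h' \<Longrightarrow> even (length h') \<Longrightarrow> prefix h h' \<Longrightarrow> force Q h'"
  shows "force Q h"
  using force_strengthen[OF assms(1-3)] assms(4) by (blast intro: force_trans)

text \<open>Induction on the forcing tree. The conclusion restricts the play only from
  \<open>h\<close> on, so that strategies for different checkpoints can be used one after
  another.\<close>

lemma force_strategy:
  assumes "force P h" "even (length h)"
  shows "\<exists>\<tau>. maker_strategy \<tau> \<and> (\<forall>p. play p \<longrightarrow> map p [0..<length h] = h \<longrightarrow>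
    (\<forall>n\<ge>length h. even n \<longrightarrow> p n = \<tau> (map p [0..<n])) \<longrightarrow>
    (\<exists>n\<ge>length h. even n \<and> P (map p [0..<n])))"
  using assms
proof induction
  case (now h)
  obtain \<tau> where "maker_strategy \<tau>" using ex_maker_strategy by blast
  with now show ?case by (intro exI[of _ \<tau>] conjI allI impI exI[of _ "length h"]) auto
next
  case (move e h)
  let ?good = "\<lambda>h \<tau>. \<forall>p. play p \<longrightarrow> map p [0..<length h] = h \<longrightarrow>
    (\<forall>n\<ge>length h. even n \<longrightarrow> p n = \<tau> (map p [0..<n])) \<longrightarrow>
    (\<exists>n\<ge>length h. even n \<and> P (map p [0..<n]))"
  \<comment> \<open>An illegal answer \<open>f\<close> gets an arbitrary legal strategy; this makes
    \<open>T\<close> total and \<open>\<tau>\<close> legal at every position.\<close>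
  have "\<forall>f. \<exists>\<tau>. maker_strategy \<tau> \<and>
      (f \<in> edges K_aleph0 - set (h @ [e]) \<longrightarrow> ?good (h @ [e, f]) \<tau>)"
  proof
    fix f show "\<exists>\<tau>. maker_strategy \<tau> \<and>
      (f \<in> edges K_aleph0 - set (h @ [e]) \<longrightarrow> ?good (h @ [e, f]) \<tau>)"
    proof (cases "f \<in> edges K_aleph0 - set (h @ [e])")
      case True
      then show ?thesis using move.IH[OF True] move.prems by auto
    next
      case False
      then show ?thesis using ex_maker_strategy by blast
    qed
  qed
  then obtain T where T: "\<And>f. maker_strategy (T f)"
    "\<And>f. f \<in> edges K_aleph0 - set (h @ [e]) \<Longrightarrow> ?good (h @ [e, f]) (T f)"
    by metis
  \<comment> \<open>Breaker's answer to \<open>e\<close> stays in the history at index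
    \<open>Suc (length h)\<close>, so it can be looked up at every later move.\<close>
  define \<tau> where "\<tau> h' = (if h' = h then e else T (h' ! Suc (length h)) h')" for h'
  have "maker_strategy \<tau>"
    using T(1) move.hyps(1) unfolding maker_strategy_def \<tau>_def by simp
  moreover have "?good h \<tau>"
  proof (intro allI impI)
    fix p assume p: "play p" and ph: "map p [0..<length h] = h"
      and f: "\<forall>n\<ge>length h. even n \<longrightarrow> p n = \<tau> (map p [0..<n])"
    have e: "p (length h) = e"
      using f move.prems ph by (auto simp: \<tau>_def)
    let ?f = "p (Suc (length h))"
    have h2: "map p [0..<length (h @ [e, ?f])] = h @ [e, ?f]"
      using ph e by simp
    have "set h = p ` {0..<length h}" using ph by (metis set_map set_upt)
    then have "?f \<notin> set (h @ [e])"
      using p e[symmetric] by (auto simp: play_def inj_eq)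
    then have mem: "?f \<in> edges K_aleph0 - set (h @ [e])"
      using p by (auto simp: play_def)
    have "p n = T ?f (map p [0..<n])" if "n \<ge> length (h @ [e, ?f])" "even n" for n
    proof -
      have "map p [0..<n] \<noteq> h" using that by (metis diff_zero length_append length_map length_upt
            add_le_same_cancel1 length_0_conv list.distinct(1) not_less_zero le_zero_eq)
      moreover have "map p [0..<n] ! Suc (length h) = ?f" using that by simp
      ultimately show ?thesis using f that by (simp add: \<tau>_def)
    qed
    then obtain n where "n \<ge> length (h @ [e, ?f])" "even n" "P (map p [0..<n])"
      using T(2)[OF mem] p h2 by blast
    then show "\<exists>n\<ge>length h. even n \<and> P (map p [0..<n])" by (intro exI[of _ n]) auto
  qed
  ultimately show ?case by blast
qed

text \<open>The second component of a state is the position at which the state was reached; the strategy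
  recomputes the current state from the history and plays to force the next one.\<close>

lemma checkpoint_strategy:
  fixes R :: "'s \<times> nat set list \<Rightarrow> 's \<times> nat set list \<Rightarrow> bool"
  assumes init: "Inv (s0, [])"
    and step: "\<And>s h. Inv (s, h) \<Longrightarrow> position h \<Longrightarrow> even (length h) \<Longrightarrow>
      force (\<lambda>h'. length h < length h' \<and> (\<exists>s'. R (s, h) (s', h') \<and> Inv (s', h'))) h"
  shows "\<exists>\<sigma>. maker_strategy \<sigma> \<and> (\<forall>p. play p \<and> follows \<sigma> p \<longrightarrow>
    (\<exists>c. c 0 = (s0, []) \<and> (\<forall>i. R (c i) (c (Suc i)) \<and> (\<exists>n. even n \<and> snd (c i) = map p [0..<n]))))"
proof -
  define good where "good c s' h' \<longleftrightarrow> length (snd c) < length h' \<and> R c (s', h') \<and> Inv (s', h')"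
    for c s' h'
  let ?ok = "\<lambda>c \<tau>. \<forall>p. play p \<longrightarrow> map p [0..<length (snd c)] = snd c \<longrightarrow>
    (\<forall>n\<ge>length (snd c). even n \<longrightarrow> p n = \<tau> (map p [0..<n])) \<longrightarrow>
    (\<exists>n\<ge>length (snd c). even n \<and> (\<exists>s'. good c s' (map p [0..<n])))"
  have "\<exists>\<tau>. maker_strategy \<tau> \<and> (Inv c \<and> position (snd c) \<and> even (length (snd c)) \<longrightarrow> ?ok c \<tau>)" for c
  proof (cases "Inv c \<and> position (snd c) \<and> even (length (snd c))")
    case True
    have "force (\<lambda>h'. \<exists>s'. good c s' h') (snd c)"
      using step[of "fst c" "snd c"] True by (simp add: good_def)
    from force_strategy[OF this] True show ?thesis by blast
  next
    case False
    then show ?thesis using ex_maker_strategy by blast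
  qed
  then obtain T where T: "\<And>c. maker_strategy (T c)"
    "\<And>c. Inv c \<Longrightarrow> position (snd c) \<Longrightarrow> even (length (snd c)) \<Longrightarrow> ?ok c (T c)"
    by metis
  \<comment> \<open>\<open>cur h i\<close> is the checkpoint in force after \<open>i\<close> rounds
    of \<open>h\<close>; it is replaced as soon as some state is good at the current prefix.\<close>
  define cur where "cur h = rec_nat (s0, []) (\<lambda>i c. if \<exists>s'. good c s' (take (2 * Suc i) h)
    then (SOME s'. good c s' (take (2 * Suc i) h), take (2 * Suc i) h) else c)" for h
  have cur_0: "cur h 0 = (s0, [])" for h by (simp add: cur_def)
  have cur_Suc: "cur h (Suc i) = (if \<exists>s'. good (cur h i) s' (take (2 * Suc i) h)
    then (SOME s'. good (cur h i) s' (take (2 * Suc i) h), take (2 * Suc i) h) else cur h i)" for h i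
    by (simp add: cur_def)
  have cur_take: "cur (take j h) i = cur h i" if "2 * i \<le> j" for h i j
    using that
  proof (induction i)
    case (Suc i)
    then have "cur (take j h) i = cur h i" by simp
    moreover have "take (2 * Suc i) (take j h) = take (2 * Suc i) h"
      using Suc.prems by (simp only: take_take min_def if_True)
    ultimately show ?case by (simp only: cur_Suc)
  qed (simp only: cur_0)
  define \<sigma> where "\<sigma> h = T (cur h (length h div 2)) h" for h
  have "maker_strategy \<sigma>"
    using T(1) unfolding maker_strategy_def \<sigma>_def by blast
  moreover have "\<exists>c. c 0 = (s0, []) \<and> (\<forall>i. R (c i) (c (Suc i)) \<and> (\<exists>n. even n \<and> snd (c i) = map p [0..<n]))"
    if p: "play p" and fol: "follows \<sigma> p" for p
  proof -
    define C where "C i = cur (map p [0..<2 * i]) i" for i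
    have C_0: "C 0 = (s0, [])" by (simp add: C_def cur_0)
    have C_Suc: "C (Suc i) = (if \<exists>s'. good (C i) s' (map p [0..<2 * Suc i])
      then (SOME s'. good (C i) s' (map p [0..<2 * Suc i]), map p [0..<2 * Suc i]) else C i)" for i
    proof -
      have "cur (map p [0..<2 * Suc i]) i = C i"
        unfolding C_def by (subst cur_take[of i "2 * i", symmetric]) (auto simp: take_map)
      then show ?thesis unfolding C_def[of "Suc i"] cur_Suc by simp
    qed
    have pos: "position (map p [0..<n])" for n
      using p by (auto simp: position_def play_def distinct_map inj_on_def)
    have C_inv: "Inv (C i)" for i
    proof (induction i)
      case 0
      then show ?case using init by (simp add: C_0)
    next
      case (Suc i)
      show ?case
      proof (cases "\<exists>s'. good (C i) s' (map p [0..<2 * Suc i])")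
        case True
        then show ?thesis using someI_ex[OF True] by (simp only: C_Suc if_True) (simp add: good_def)
      qed (use Suc in \<open>simp only: C_Suc if_False\<close>)
    qed
    \<comment> \<open>The index in \<open>Reach\<close> is the round at which \<open>c\<close> was
      created; between creations \<open>C\<close> is constant.\<close>
    define Reach where "Reach c \<longleftrightarrow> (\<exists>i. C i = c \<and> snd c = map p [0..<2 * i])" for c
    have progress: "\<exists>c'. Reach c' \<and> R c c'" if "Reach c" for c
    proof -
      from that obtain i where i: "C i = c" "snd c = map p [0..<2 * i]" by (auto simp: Reach_def)
      let ?g = "\<lambda>i'. i' \<ge> i \<and> (\<exists>s'. good c s' (map p [0..<2 * Suc i']))"
      have stay: "C i' = c" if "i' \<ge> i" "\<forall>j<i'. \<not> ?g j" for i'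
        using that
      proof (induction i' rule: dec_induct)
        case (step j)
        then have Cj: "C j = c" by auto
        moreover have "\<not> (\<exists>s'. good c s' (map p [0..<2 * Suc j]))" using step by blast
        ultimately show ?case by (simp only: C_Suc if_False)
      qed (use i in simp)
      \<comment> \<open>Without a next checkpoint \<open>C\<close> stays at \<open>c\<close>, so
        \<open>\<sigma>\<close> plays \<open>T c\<close> forever, and that forces a good
        state.\<close>
      have "\<exists>i'. ?g i'"
      proof (rule ccontr)
        assume neg: "\<nexists>i'. ?g i'"
        have run: "\<forall>n\<ge>length (snd c). even n \<longrightarrow> p n = T c (map p [0..<n])"
        proof (intro allI impI)
          fix n assume that: "n \<ge> length (snd c)" "even n"
          from \<open>even n\<close> obtain j where n: "n = 2 * j" by (elim evenE)
          have "j \<ge> i" using that i n by simp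
          then have "C j = c" using stay neg by blast
          moreover have "p n = \<sigma> (map p [0..<n])" using fol that by (auto simp: follows_def)
          ultimately show "p n = T c (map p [0..<n])" unfolding \<sigma>_def C_def n by simp
        qed
        have Inv_c: "Inv c" using C_inv[of i] i by simp
        have pos_c: "position (snd c)" "even (length (snd c))"
          using pos[of "2 * i"] i(2) by simp_all
        have pre_c: "map p [0..<length (snd c)] = snd c" using i(2) by simp
        obtain n where n: "n \<ge> length (snd c)" "even n" "\<exists>s'. good c s' (map p [0..<n])"
          using T(2)[OF Inv_c pos_c, THEN spec, THEN mp, OF p, THEN mp, OF pre_c, THEN mp, OF run]
          by blast
        from n(3) have "n > length (snd c)" by (auto simp: good_def)
        with n(2) obtain j where "n = 2 * Suc j"
          by (metis evenE not_less_zero not0_implies_Suc mult_0_right)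
        moreover have "j \<ge> i" using \<open>n > length (snd c)\<close> i \<open>n = 2 * Suc j\<close> by simp
        ultimately show False using neg n(3) by blast
      qed
      then obtain i' where i': "?g i'" "\<forall>j<i'. \<not> ?g j"
        using exists_least_iff[of ?g] by blast
      have "C i' = c" using stay i' by blast
      moreover have ex: "\<exists>s'. good c s' (map p [0..<2 * Suc i'])" using i' by blast
      ultimately have C': "C (Suc i') = (SOME s'. good c s' (map p [0..<2 * Suc i']), map p [0..<2 * Suc i'])"
        by (simp only: C_Suc if_True)
      then have "R c (C (Suc i'))" using someI_ex[OF ex] unfolding C' good_def by (elim conjE)
      moreover have "Reach (C (Suc i'))" unfolding Reach_def using C' by (metis snd_conv)
      ultimately show ?thesis by blast
    qed
    have "\<exists>c. \<forall>i. Reach (c i) \<and> (c 0 = (s0, [])) \<and> R (c i) (c (Suc i))"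
    proof -
      have "\<exists>c. \<forall>i. (Reach (c i) \<and> (i = 0 \<longrightarrow> c i = (s0, []))) \<and> R (c i) (c (Suc i))"
      proof (rule dependent_nat_choice)
        show "\<exists>x. Reach x \<and> (0 = (0::nat) \<longrightarrow> x = (s0, []))"
          by (rule exI[of _ "(s0, [])"]) (auto simp: Reach_def intro!: exI[of _ 0] C_0)
      qed (use progress in force)
      then show ?thesis by metis
    qed
    then obtain c where c: "\<And>i. Reach (c i)" "c 0 = (s0, [])" "\<And>i. R (c i) (c (Suc i))" by metis
    have "\<exists>n. even n \<and> snd (c i) = map p [0..<n]" for i
      using c(1)[of i] unfolding Reach_def by (metis dvd_triv_left)
    with c show ?thesis by blast
  qed
  ultimately show ?thesis by blast
qed

section \<open>A clique of centres\<close>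

definition maker_claimed :: "'a list \<Rightarrow> 'a set" where
  "maker_claimed h = (!) h ` {i. i < length h \<and> even i}"

lemma maker_claimed_append_two:
  assumes "even (length h)"
  shows "maker_claimed (h @ [e, f]) = insert e (maker_claimed h)"
proof -
  have "{i. i < length (h @ [e, f]) \<and> even i} = insert (length h) {i. i < length h \<and> even i}"
    using assms by (auto simp: less_Suc_eq)
  then have "maker_claimed (h @ [e, f]) = (!) (h @ [e, f]) ` insert (length h) {i. i < length h \<and> even i}"
    unfolding maker_claimed_def by (rule arg_cong)
  also have "\<dots> = insert e (maker_claimed h)"
    by (auto simp: maker_claimed_def nth_append)
  finally show ?thesis .
qed

lemma maker_claimed_mono_prefix: "prefix h h' \<Longrightarrow> maker_claimed h \<subseteq> maker_claimed h'"
  by (fastforce simp: maker_claimed_def prefix_def nth_append)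

lemma maker_claimed_subset_set: "maker_claimed h \<subseteq> set h"
  by (auto simp: maker_claimed_def)

section \<open>Joining one vertex to many vertices of prescribed sets\<close>

definition available :: "nat set list \<Rightarrow> nat \<Rightarrow> nat set \<Rightarrow> nat set" where
  "available h x B = {y\<in>B. y \<noteq> x \<and> {x, y} \<notin> set h}"

lemma card_star_le:
  assumes "finite F"
  shows "finite {y. {x, y} \<in> F}" "card {y. {x, y} \<in> F} \<le> card {e\<in>F. x \<in> e}"
proof -
  have inj: "inj_on (\<lambda>y. {x, y}) {y. {x, y} \<in> F}"
    by (auto simp: inj_on_def doubleton_eq_iff)
  have sub: "(\<lambda>y. {x, y}) ` {y. {x, y} \<in> F} \<subseteq> {e\<in>F. x \<in> e}" by auto
  show "finite {y. {x, y} \<in> F}"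
    using inj sub assms by (auto intro: inj_on_finite)
  show "card {y. {x, y} \<in> F} \<le> card {e\<in>F. x \<in> e}"
    using inj sub assms by (intro card_inj_on_le[of "\<lambda>y. {x, y}"]) auto
qed

text \<open>With \<open>x\<close> fixed, every additional edge rules out at most one element of
  \<open>B\<close>.\<close>

lemma card_available_append:
  assumes "finite B"
  shows "card (available h x B) \<le> card (available (h @ r) x B) + length r"
proof -
  have "available h x B \<subseteq> available (h @ r) x B \<union> {y. {x, y} \<in> set r}"
    by (auto simp: available_def)
  then have "card (available h x B) \<le> card (available (h @ r) x B \<union> {y. {x, y} \<in> set r})"
    using assms card_star_le(1)[of "set r" x] by (intro card_mono) (auto simp: available_def)
  also have "\<dots> \<le> card (available (h @ r) x B) + card {y. {x, y} \<in> set r}"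
    by (rule card_Un_le)
  also have "card {y. {x, y} \<in> set r} \<le> card {e\<in>set r. x \<in> e}"
    by (rule card_star_le) simp
  also have "\<dots> \<le> card (set r)" by (intro card_mono) auto
  also have "\<dots> \<le> length r" by (rule card_length)
  finally show ?thesis by simp
qed

text \<open>A round uses up at most two candidates, one taken by Maker and one spoilt by Breaker;
  hence the factor \<open>2\<close>.\<close>

lemma force_star:
  assumes "position h" "even (length h)" "finite B" "2 * t \<le> card (available h x B)"
  shows "force (\<lambda>h'. length h' = length h + 2 * t \<and>
    (\<exists>Y\<subseteq>available h x B. card Y = t \<and> (\<forall>y\<in>Y. {x, y} \<in> maker_claimed h'))) h"
  using assms
proof (induction t arbitrary: h)
  case 0
  then show ?case by (intro force.now) (auto intro!: exI[of _ "{}"])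
next
  case (Suc t)
  then have "available h x B \<noteq> {}" by auto
  then obtain y where y: "y \<in> available h x B" by blast
  show ?case
  proof (rule force.move)
    show e: "{x, y} \<in> edges K_aleph0 - set h"
      using y by (auto simp: available_def edge_K_aleph0_iff)
    fix f assume f: "f \<in> edges K_aleph0 - set (h @ [{x, y}])"
    let ?h = "h @ [{x, y}, f]"
    have pos: "position ?h" "even (length ?h)"
      using e f Suc.prems by (auto simp: position_def)
    have "2 * t \<le> card (available ?h x B)"
      using card_available_append[OF Suc.prems(3), of h x "[{x, y}, f]"] Suc.prems(4) by simp
    from Suc.IH[OF pos Suc.prems(3) this]
    show "force (\<lambda>h'. length h' = length h + 2 * Suc t \<and>
      (\<exists>Y\<subseteq>available h x B. card Y = Suc t \<and> (\<forall>y\<in>Y. {x, y} \<in> maker_claimed h'))) ?h"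
    proof (rule force_then[OF _ pos])
      fix h' assume h': "length h' = length ?h + 2 * t \<and>
        (\<exists>Y\<subseteq>available ?h x B. card Y = t \<and> (\<forall>y\<in>Y. {x, y} \<in> maker_claimed h'))" and pre: "prefix ?h h'"
      then obtain Y where Y: "Y \<subseteq> available ?h x B" "card Y = t" "\<forall>y\<in>Y. {x, y} \<in> maker_claimed h'" by blast
      have "finite Y" using Y(1) Suc.prems(3) by (auto simp: available_def intro: finite_subset)
      moreover have "y \<notin> Y" using Y(1) by (auto simp: available_def)
      ultimately have "card (insert y Y) = Suc t" using Y(2) by simp
      moreover have "{x, y} \<in> maker_claimed h'"
        using maker_claimed_mono_prefix[OF pre] maker_claimed_append_two[OF Suc.prems(2)] by auto
      moreover have "insert y Y \<subseteq> available h x B" using Y(1) y by (auto simp: available_def)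
      ultimately show "force (\<lambda>h'. length h' = length h + 2 * Suc t \<and>
        (\<exists>Y\<subseteq>available h x B. card Y = Suc t \<and> (\<forall>y\<in>Y. {x, y} \<in> maker_claimed h'))) h'"
        using Y(3) h' by (intro force.now conjI exI[of _ "insert y Y"]) auto
    qed
  qed
qed

text \<open>While one set is served Breaker may spoil vertices of the others, so each set must start
  with candidates for all rounds. The exact length is kept because it bounds the number of edges
  that can lie inside the chosen sets.\<close>

lemma force_stars:
  assumes "position h" "even (length h)"
    "\<And>B. B \<in> set Bs \<Longrightarrow> finite B \<and> 2 * t * length Bs \<le> card (available h x B)"
  shows "force (\<lambda>h'. length h' = length h + 2 * t * length Bs \<and>
    (\<exists>Ys. list_all2 (\<lambda>Y B. Y \<subseteq> available h x B \<and> card Y = t \<and> (\<forall>y\<in>Y. {x, y} \<in> maker_claimed h')) Ys Bs)) h"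
  using assms
proof (induction Bs arbitrary: h)
  case Nil
  then show ?case by (intro force.now) auto
next
  case (Cons B Bs)
  have "2 * t \<le> card (available h x B)" "finite B" using Cons.prems(3)[of B] by auto
  from force_star[OF Cons.prems(1,2) this(2,1)] show ?case
  proof (rule force_then[OF _ Cons.prems(1,2)])
    fix h1 assume h1: "length h1 = length h + 2 * t \<and>
      (\<exists>Y\<subseteq>available h x B. card Y = t \<and> (\<forall>y\<in>Y. {x, y} \<in> maker_claimed h1))"
      and pos: "position h1" "even (length h1)" and "prefix h h1"
    then obtain r where r: "h1 = h @ r" "length r = 2 * t" by (auto simp: prefix_def)
    obtain Y where Y: "Y \<subseteq> available h x B" "card Y = t" "\<forall>y\<in>Y. {x, y} \<in> maker_claimed h1" using h1 by blast
    have "finite B' \<and> 2 * t * length Bs \<le> card (available h1 x B')" if "B' \<in> set Bs" for B'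
      using Cons.prems(3)[of B'] card_available_append[of B' h x r] that r by simp
    from Cons.IH[OF pos this] show "force (\<lambda>h'. length h' = length h + 2 * t * length (B # Bs) \<and>
      (\<exists>Ys. list_all2 (\<lambda>Y B. Y \<subseteq> available h x B \<and> card Y = t \<and> (\<forall>y\<in>Y. {x, y} \<in> maker_claimed h')) Ys (B # Bs))) h1"
    proof (rule force_then[OF _ pos])
      fix h' assume h': "length h' = length h1 + 2 * t * length Bs \<and>
        (\<exists>Ys. list_all2 (\<lambda>Y B. Y \<subseteq> available h1 x B \<and> card Y = t \<and> (\<forall>y\<in>Y. {x, y} \<in> maker_claimed h')) Ys Bs)"
        and pre: "prefix h1 h'"
      then obtain Ys where Ys:
        "list_all2 (\<lambda>Y B. Y \<subseteq> available h1 x B \<and> card Y = t \<and> (\<forall>y\<in>Y. {x, y} \<in> maker_claimed h')) Ys Bs" by blast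
      have "available h1 x B' \<subseteq> available h x B'" for B' using r by (auto simp: available_def)
      then have "list_all2 (\<lambda>Y B. Y \<subseteq> available h x B \<and> card Y = t \<and> (\<forall>y\<in>Y. {x, y} \<in> maker_claimed h')) Ys Bs"
        by (intro list_all2_mono[OF Ys]) blast
      then have "list_all2 (\<lambda>Y B. Y \<subseteq> available h x B \<and> card Y = t \<and> (\<forall>y\<in>Y. {x, y} \<in> maker_claimed h')) (Y # Ys) (B # Bs)"
        using Y maker_claimed_mono_prefix[OF pre] by auto
      then show "force (\<lambda>h'. length h' = length h + 2 * t * length (B # Bs) \<and>
        (\<exists>Ys. list_all2 (\<lambda>Y B. Y \<subseteq> available h x B \<and> card Y = t \<and> (\<forall>y\<in>Y. {x, y} \<in> maker_claimed h')) Ys (B # Bs))) h'"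
        using h' h1 by (intro force.now) auto
    qed
  qed
qed

text \<open>Fewer than \<open>K\<close> earlier choices exclude fewer than \<open>K * D\<close>
  candidates.\<close>

lemma greedy_independent:
  assumes W: "\<And>q. q < K \<Longrightarrow> K * D \<le> card (W q)"
    and nb: "\<And>q y. q < K \<Longrightarrow> y \<in> W q \<Longrightarrow> finite (nb y) \<and> card (nb y) \<le> D"
    and D: "D > 0"
  shows "\<exists>z. \<forall>q<K. z q \<in> W q \<and> (\<forall>q'<q. z q \<notin> nb (z q'))"
proof -
  have "\<exists>z. \<forall>q<J. z q \<in> W q \<and> (\<forall>q'<q. z q \<notin> nb (z q'))" if "J \<le> K" for J
    using that
  proof (induction J)
    case (Suc J)
    then obtain z where z: "\<forall>q<J. z q \<in> W q \<and> (\<forall>q'<q. z q \<notin> nb (z q'))" by auto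
    let ?F = "\<Union>q<J. nb (z q)"
    have nbz: "finite (nb (z q)) \<and> card (nb (z q)) \<le> D" if "q < J" for q
      using z nb[of q "z q"] that Suc.prems by auto
    then have fin: "finite ?F" by blast
    have "card ?F \<le> (\<Sum>q<J. card (nb (z q)))" by (rule card_UN_le) simp
    also have "\<dots> \<le> (\<Sum>q<J. D)" by (rule sum_mono) (use nbz in auto)
    also have "\<dots> = J * D" by simp
    also have "\<dots> < K * D" using Suc.prems D by simp
    also have "\<dots> \<le> card (W J)" using W[of J] Suc.prems by simp
    finally have "\<exists>y\<in>W J. y \<notin> ?F"
      using card_mono[OF fin] by (metis linorder_not_less subsetI)
    then obtain y where y: "y \<in> W J" "y \<notin> ?F" by blast
    then show ?case using z by (intro exI[of _ "z(J := y)"]) (auto simp: less_Suc_eq)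
  qed simp
  from this[of K] show ?thesis by simp
qed


text \<open>\<open>F\<close> stands for the edges claimed while \<open>N\<close> stars with
  \<open>16 * N ^ 2 * a\<close> leaves are built. Its degrees sum to at most
  \<open>8 * N * (8 * N ^ 2 * a)\<close>, so at least half of each \<open>Y i\<close> has degree
  below \<open>8 * N\<close>, and that half leaves room for \<open>N * a\<close> greedy
  choices.\<close>

lemma prune_edges:
  fixes Y :: "nat \<Rightarrow> nat set"
  assumes F: "finite F" "\<And>e. e \<in> F \<Longrightarrow> finite e \<and> card e \<le> 2"
    and cF: "card F \<le> 2 * (16 * N ^ 2 * a) * N"
    and Y: "\<And>i. i < N \<Longrightarrow> finite (Y i) \<and> card (Y i) = 16 * N ^ 2 * a"
  shows "\<exists>Z. (\<forall>i<N. Z i \<subseteq> Y i \<and> card (Z i) = a) \<and>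
    (\<forall>y\<in>\<Union>i<N. Z i. \<forall>z\<in>\<Union>i<N. Z i. y \<noteq> z \<longrightarrow> {y, z} \<notin> F)"
proof (cases "N = 0 \<or> a = 0")
  case True
  then show ?thesis by (intro exI[of _ "\<lambda>_. {}"]) auto
next
  case False
  define deg where "deg y = card {e\<in>F. y \<in> e}" for y
  \<comment> \<open>Forbidding \<open>y\<close> itself makes all chosen vertices distinct, also
    across sets; the strict bound \<open>deg y < 8 * N\<close> leaves room for it.\<close>
  define nb where "nb y = insert y {z. {y, z} \<in> F}" for y
  define W where "W i = {y\<in>Y i. deg y < 8 * N}" for i
  have W: "8 * N ^ 2 * a \<le> card (W i)" if i: "i < N" for i
  proof -
    let ?B = "{y\<in>Y i. 8 * N \<le> deg y}"
    have fB: "finite ?B" using Y[OF i] by auto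
    have "8 * N * card ?B = (\<Sum>y\<in>?B. 8 * N)" by simp
    also have "\<dots> \<le> (\<Sum>y\<in>?B. deg y)" by (rule sum_mono) simp
    also have "\<dots> = (\<Sum>y\<in>?B. \<Sum>e\<in>F. if y \<in> e then 1 else 0)"
      using F(1) by (simp add: deg_def sum.If_cases Int_def conj_commute)
    also have "\<dots> = (\<Sum>e\<in>F. \<Sum>y\<in>?B. if y \<in> e then 1 else 0)" by (rule sum.swap)
    also have "\<dots> \<le> (\<Sum>e\<in>F. 2)"
    proof (rule sum_mono)
      fix e assume e: "e \<in> F"
      have "(\<Sum>y\<in>?B. if y \<in> e then 1 else 0) = card (?B \<inter> e)"
        using fB by (simp add: sum.If_cases)
      also have "\<dots> \<le> card e" using F(2)[OF e] by (intro card_mono) auto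
      finally show "(\<Sum>y\<in>?B. if y \<in> e then 1 else 0) \<le> (2::nat)" using F(2)[OF e] by simp
    qed
    also have "\<dots> \<le> 8 * N * (8 * N ^ 2 * a)" using cF by (simp add: power2_eq_square ac_simps)
    finally have "card ?B \<le> 8 * N ^ 2 * a" using False by (simp add: ac_simps)
    moreover have "card (Y i) = card (W i) + card ?B"
    proof -
      have "Y i = W i \<union> ?B" "W i \<inter> ?B = {}" by (auto simp: W_def)
      then show ?thesis using Y[OF i] by (metis card_Un_disjoint finite_Un)
    qed
    ultimately show ?thesis using Y[OF i] by simp
  qed
  have nb: "finite (nb y) \<and> card (nb y) \<le> 8 * N" if "y \<in> W i" for y i
  proof -
    have "card (nb y) \<le> Suc (card {z. {y, z} \<in> F})"
      unfolding nb_def by (rule card_insert_le_m1) simp_all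
    with card_star_le[OF F(1), of y] that show ?thesis by (auto simp: W_def deg_def nb_def)
  qed
  \<comment> \<open>One greedy run serves all sets: index \<open>q\<close> stands for choice
    \<open>q mod a\<close> in set \<open>q div a\<close>.\<close>
  have "\<exists>z. \<forall>q<N * a. z q \<in> W (q div a) \<and> (\<forall>q'<q. z q \<notin> nb (z q'))"
  proof (rule greedy_independent)
    show "N * a * (8 * N) \<le> card (W (q div a))" if "q < N * a" for q
      using W[of "q div a"] that by (simp add: less_mult_imp_div_less power2_eq_square algebra_simps)
  qed (use nb False in auto)
  then obtain z where z: "\<And>q. q < N * a \<Longrightarrow> z q \<in> W (q div a)"
    "\<And>q q'. q < N * a \<Longrightarrow> q' < q \<Longrightarrow> z q \<notin> nb (z q')" by blast
  have inj: "inj_on z {..<N * a}"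
    by (rule linorder_inj_onI) (use z(2) in \<open>force simp: nb_def\<close>)+
  have bound: "i * a + r < N * a" "(i * a + r) div a = i" if "i < N" "r < a" for i r
  proof -
    have "i * a + r < Suc i * a" using that by simp
    also have "\<dots> \<le> N * a" using that by (intro mult_right_mono) auto
    finally show "i * a + r < N * a" .
    show "(i * a + r) div a = i" using that by simp
  qed
  define Z where "Z i = (\<lambda>r. z (i * a + r)) ` {..<a}" for i
  have "Z i \<subseteq> Y i \<and> card (Z i) = a" if i: "i < N" for i
  proof
    show "Z i \<subseteq> Y i" using z(1) bound[OF i] by (fastforce simp: Z_def W_def)
    have "inj_on (\<lambda>r. z (i * a + r)) {..<a}"
    proof (rule inj_onI)
      fix r r' assume r: "r \<in> {..<a}" "r' \<in> {..<a}" and eq: "z (i * a + r) = z (i * a + r')"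
      from r have "i * a + r \<in> {..<N * a}" "i * a + r' \<in> {..<N * a}"
        using bound(1)[OF i] by blast+
      with inj_onD[OF inj eq] have "i * a + r = i * a + r'" .
      then show "r = r'" by simp
    qed
    then show "card (Z i) = a" by (simp add: Z_def card_image)
  qed
  moreover have "{y, y'} \<notin> F" if "y \<in> (\<Union>i<N. Z i)" "y' \<in> (\<Union>i<N. Z i)" "y \<noteq> y'" for y y'
  proof -
    have index: "\<exists>q<N * a. y = z q" if "y \<in> (\<Union>i<N. Z i)" for y
      using that bound(1) unfolding Z_def by blast
    from index[OF that(1)] index[OF that(2)]
    obtain q q' where q: "y = z q" "q < N * a" "y' = z q'" "q' < N * a" by blast
    with that have "q < q' \<or> q' < q" by (metis linorder_neqE_nat)
    then show ?thesis using z(2)[of q q'] z(2)[of q' q] q by (auto simp: nb_def insert_commute)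
  qed
  ultimately show ?thesis by blast
qed

text \<open>Pick \<open>x\<close> in the first set, join it to many vertices of each other set, and thin these out to
  smaller sets that span no claimed edge.\<close>

lemma force_clique:
  assumes "position h" "even (length h)" "length As \<le> N"
    and "\<And>A. A \<in> set As \<Longrightarrow> finite A \<and> (33 * N ^ 3) ^ length As \<le> card A"
    and "\<And>y z. y \<in> \<Union>(set As) \<Longrightarrow> z \<in> \<Union>(set As) \<Longrightarrow> y \<noteq> z \<Longrightarrow> {y, z} \<notin> set h"
  shows "force (\<lambda>h'. \<exists>xs. list_all2 (\<in>) xs As \<and>
    (\<forall>i<length xs. \<forall>j<i. {xs ! j, xs ! i} \<in> maker_claimed h')) h"
  using assms
proof (induction "length As" arbitrary: As h)
  case 0
  then show ?case by (intro force.now) auto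
next
  case (Suc M)
  then obtain A Bs where As: "As = A # Bs" and M_def: "M = length Bs" by (cases As) auto
  note prems = Suc.prems[unfolded As]
  \<comment> \<open>\<open>32 * N ^ 3\<close> pays for the stars and their thinning, the remaining
    \<open>N ^ 3\<close> for the possible loss of \<open>x\<close>. As \<open>N\<close> stays fixed,
    every level of the recursion divides the sizes by the same \<open>b\<close>.\<close>
  define b where "b = 33 * N ^ 3"
  define a where "a = b ^ M"
  define t where "t = 16 * M ^ 2 * a"
  have N: "N \<ge> 1" "M < N" using prems(3) by (auto simp: M_def)
  have "b \<ge> 1" using N by (simp add: b_def)
  then have a: "a \<ge> 1" by (simp add: a_def)
  have large: "finite B \<and> b * a \<le> card B" if "B \<in> set (A # Bs)" for B
    using prems(4)[OF that] by (simp add: a_def b_def M_def)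
  have "A \<noteq> {}" using large[of A] \<open>b \<ge> 1\<close> a by auto
  then obtain x where x: "x \<in> A" by blast
  have av: "finite B \<and> 2 * t * length Bs \<le> card (available h x B)" if B: "B \<in> set Bs" for B
  proof -
    have "available h x B = B - {x}" using prems(5) x B by (auto simp: available_def)
    then have "card B - 1 \<le> card (available h x B)"
      by (simp add: card_Diff_singleton_if)
    moreover have "2 * t * length Bs < b * a"
    proof -
      have "2 * t * length Bs = 32 * M ^ 3 * a"
        by (simp add: t_def M_def power2_eq_square power3_eq_cube)
      also have "\<dots> \<le> 32 * N ^ 3 * a" using N by (intro mult_right_mono mult_left_mono power_mono) auto
      also have "\<dots> < b * a" using a N by (simp add: b_def)
      finally show ?thesis .
    qed
    ultimately show ?thesis using large[of B] B by auto
  qed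
  from force_stars[OF prems(1,2) av] show ?case
  proof (rule force_then[OF _ prems(1,2)])
    fix h1 assume h1: "length h1 = length h + 2 * t * length Bs \<and>
      (\<exists>Ys. list_all2 (\<lambda>Y B. Y \<subseteq> available h x B \<and> card Y = t \<and> (\<forall>y\<in>Y. {x, y} \<in> maker_claimed h1)) Ys Bs)"
      and pos: "position h1" "even (length h1)" and "prefix h h1"
    then obtain r where r: "h1 = h @ r" "length r = 2 * t * M" by (auto simp: prefix_def M_def)
    obtain Ys where Ys: "length Ys = M" "\<And>i. i < M \<Longrightarrow> Ys ! i \<subseteq> available h x (Bs ! i) \<and>
        card (Ys ! i) = t \<and> (\<forall>y\<in>Ys ! i. {x, y} \<in> maker_claimed h1)"
      using h1 unfolding list_all2_conv_all_nth M_def by metis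
    have YB: "Ys ! i \<subseteq> Bs ! i - {x}" "finite (Ys ! i)" if "i < M" for i
    proof -
      show "Ys ! i \<subseteq> Bs ! i - {x}" using Ys(2)[OF that] by (auto simp: available_def)
      moreover have "finite (Bs ! i)" using large that by (simp add: M_def)
      ultimately show "finite (Ys ! i)" by (meson finite_Diff finite_subset)
    qed
    have "\<exists>Z. (\<forall>i<M. Z i \<subseteq> Ys ! i \<and> card (Z i) = a) \<and>
      (\<forall>y\<in>\<Union>i<M. Z i. \<forall>z\<in>\<Union>i<M. Z i. y \<noteq> z \<longrightarrow> {y, z} \<notin> set r)"
    proof (rule prune_edges)
      have "set r \<subseteq> edges K_aleph0" using pos r by (auto simp: position_def)
      then show "finite e \<and> card e \<le> 2" if "e \<in> set r" for e
        using that by (force elim!: edges_K_aleph0_cases)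
      show "card (set r) \<le> 2 * (16 * M ^ 2 * a) * M"
        using card_length[of r] r by (simp add: t_def)
    qed (use Ys YB in \<open>auto simp: t_def\<close>)
    then obtain Z where Z: "\<And>i. i < M \<Longrightarrow> Z i \<subseteq> Ys ! i \<and> card (Z i) = a"
      "\<And>y z. y \<in> (\<Union>i<M. Z i) \<Longrightarrow> z \<in> (\<Union>i<M. Z i) \<Longrightarrow> y \<noteq> z \<Longrightarrow> {y, z} \<notin> set r" by blast
    let ?Zs = "map Z [0..<M]"
    have "force (\<lambda>h'. \<exists>xs. list_all2 (\<in>) xs ?Zs \<and>
      (\<forall>i<length xs. \<forall>j<i. {xs ! j, xs ! i} \<in> maker_claimed h')) h1"
    proof (rule Suc.hyps(1)[OF _ pos])
      show "M = length ?Zs" by simp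
      show "length ?Zs \<le> N" using N by simp
      show "finite B \<and> (33 * N ^ 3) ^ length ?Zs \<le> card B" if "B \<in> set ?Zs" for B
      proof -
        from that obtain i where i: "i < M" "B = Z i" by auto
        then have "finite B" using Z(1)[OF i(1)] YB(2)[OF i(1)] finite_subset by blast
        then show ?thesis using Z(1)[OF i(1)] i by (simp add: a_def b_def)
      qed
      show "{y, z} \<notin> set h1" if "y \<in> \<Union>(set ?Zs)" "z \<in> \<Union>(set ?Zs)" "y \<noteq> z" for y z
      proof -
        have U: "\<Union>(set ?Zs) = (\<Union>i<M. Z i)" by auto
        have "(\<Union>i<M. Z i) \<subseteq> \<Union>(set Bs)" using Z(1) YB(1) by (fastforce simp: M_def)
        then have "y \<in> \<Union>(set (A # Bs))" "z \<in> \<Union>(set (A # Bs))" using that unfolding U by auto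
        then have "{y, z} \<notin> set h" using prems(5) that(3) by blast
        moreover have "{y, z} \<notin> set r" using Z(2) that unfolding U by blast
        ultimately show ?thesis using r by simp
      qed
    qed
    then show "force (\<lambda>h'. \<exists>xs. list_all2 (\<in>) xs As \<and>
      (\<forall>i<length xs. \<forall>j<i. {xs ! j, xs ! i} \<in> maker_claimed h')) h1"
    proof (rule force_then[OF _ pos])
      fix h' assume "\<exists>xs. list_all2 (\<in>) xs ?Zs \<and> (\<forall>i<length xs. \<forall>j<i. {xs ! j, xs ! i} \<in> maker_claimed h')"
        and pre: "prefix h1 h'"
      then obtain xs where xs: "length xs = M" "\<And>i. i < M \<Longrightarrow> xs ! i \<in> Z i"
        "\<forall>i<length xs. \<forall>j<i. {xs ! j, xs ! i} \<in> maker_claimed h'" by (auto simp: list_all2_conv_all_nth)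
      have "list_all2 (\<in>) (x # xs) (A # Bs)"
      proof -
        have "xs ! i \<in> Bs ! i" if "i < M" for i
          using xs(2)[OF that] Z(1)[OF that] YB(1)[OF that] by blast
        then have "list_all2 (\<in>) xs Bs" using xs(1) by (intro list_all2_all_nthI) (simp_all add: M_def)
        then show ?thesis using x by simp
      qed
      moreover have "\<forall>i<length (x # xs). \<forall>j<i. {(x # xs) ! j, (x # xs) ! i} \<in> maker_claimed h'"
      proof (intro allI impI)
        fix i j assume ij: "i < length (x # xs)" "j < i"
        then obtain i' where i': "i = Suc i'" by (cases i) auto
        show "{(x # xs) ! j, (x # xs) ! i} \<in> maker_claimed h'"
        proof (cases j)
          case 0
          have "i' < M" using ij i' xs(1) by simp
          then have "xs ! i' \<in> Ys ! i'" using xs(2)[of i'] Z(1)[of i'] by blast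
          then have "{x, xs ! i'} \<in> maker_claimed h'"
            using Ys(2)[OF \<open>i' < M\<close>] maker_claimed_mono_prefix[OF pre] by blast
          then show ?thesis using 0 i' by simp
        next
          case (Suc j')
          then show ?thesis using ij i' xs(3) by auto
        qed
      qed
      ultimately show "force (\<lambda>h'. \<exists>xs. list_all2 (\<in>) xs As \<and>
        (\<forall>i<length xs. \<forall>j<i. {xs ! j, xs ! i} \<in> maker_claimed h')) h'"
        unfolding As by (intro force.now) blast
    qed
  qed
qed

section \<open>Balanced walks\<close>

definition visits :: "(nat \<Rightarrow> nat list) \<Rightarrow> nat list \<Rightarrow> nat set" where
  "visits P u = {t. prefix u (P t)}"

definition visit_count :: "('a \<times> nat list) list \<Rightarrow> nat list \<Rightarrow> nat" where
  "visit_count L u = length (filter (\<lambda>(v, Q). prefix u Q) L)"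

definition block_index :: "(nat \<Rightarrow> nat set) \<Rightarrow> nat \<Rightarrow> nat \<Rightarrow> nat" where
  "block_index Q n s = (THE j. j < n \<and> s \<in> Q j)"

text \<open>A walk \<open>u\<close> of a leaf starts at the leaf's own centre, which lies in block \<open>block_index Q n (hd u)\<close>, and
  visits the blocks in cyclic order. So the first \<open>n\<close> entries are a rotation of a transversal \<open>X\<close>, and
  the remaining entries \<open>w\<close> are earlier leaves. The options after \<open>rotate j X @ w\<close> are the children of
  \<open>w\<close>; these are leaves of the centre \<open>X ! (length w mod n)\<close>, inserted by a walk that stopped at
  \<open>rotate (length w) X @ w\<close>.\<close>

definition opts :: "(nat \<Rightarrow> nat set) \<Rightarrow> nat \<Rightarrow> (nat \<times> nat list) list \<Rightarrow> nat list \<Rightarrow> nat set" where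
  "opts Q n L u = (if u = [] then \<Union>j<n. Q j
     else if length u < n then Q ((block_index Q n (hd u) + length u) mod n)
     else {v. (v, rotate (length u - block_index Q n (hd u)) (take n u) @ drop n u) \<in> set L})"

text \<open>\<open>B\<close> collects the options whose edge to the walking vertex is claimed: after \<open>length u\<close> moves of each
  player there are at most \<open>2 * length u\<close> of them. The walk goes on only with more than
  \<open>2 * n * length u\<close> options, so that some option is neglected by none of the \<open>n\<close> kinds of leaves.\<close>

definition greedy_step :: "(nat list \<Rightarrow> nat set) \<Rightarrow> (nat list \<Rightarrow> nat) \<Rightarrow> nat \<Rightarrow> nat list \<Rightarrow> nat \<Rightarrow> bool" where
  "greedy_step N c n u w \<longleftrightarrow> 2 * n * length u < card (N u) \<and>
     (\<exists>B. finite B \<and> card B \<le> 2 * length u \<and> w \<in> N u - B \<and>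
        (\<forall>w'\<in>N u - B. c (u @ [w]) \<le> c (u @ [w'])))"

definition greedy_path :: "(nat list \<Rightarrow> nat set) \<Rightarrow> (nat list \<Rightarrow> nat) \<Rightarrow> nat \<Rightarrow> nat list \<Rightarrow> bool" where
  "greedy_path N c n P \<longleftrightarrow> (\<forall>i<length P. greedy_step N c n (take i P) (P ! i))"

text \<open>The bound is the negation of the threshold in \<open>greedy_step\<close>: a walk stops
  only where the options are too few.\<close>

definition maximal_greedy_path where
  "maximal_greedy_path N c n P \<longleftrightarrow> greedy_path N c n P \<and> card (N P) \<le> 2 * n * length P"

text \<open>These are at most the first \<open>q + 1\<close> elements of \<open>S\<close>.\<close>

lemma finite_few_predecessors:
  fixes S :: "nat set"
  shows "finite {t\<in>S. card (S \<inter> {..<t}) \<le> q}"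
proof (rule ccontr)
  assume inf: "infinite {t\<in>S. card (S \<inter> {..<t}) \<le> q}" (is "infinite ?T")
  then obtain F where F: "finite F" "card F = q + 1" "F \<subseteq> ?T"
    using infinite_arbitrarily_large by blast
  obtain t where t: "t \<in> ?T" "Max F < t"
    using inf F by (metis (no_types, lifting) infinite_nat_iff_unbounded)
  then have "F \<subseteq> S \<inter> {..<t}"
    using F by (auto intro: le_less_trans[OF Max_ge])
  then have "q + 1 \<le> card (S \<inter> {..<t})"
    using F by (metis card_mono finite_Int finite_lessThan)
  with t show False by simp
qed

lemma visit_count_map:
  "visit_count (map (\<lambda>i. (v i, P i)) [0..<t]) u = card (visits P u \<inter> {..<t})"
proof -
  have "{i. i < t \<and> prefix u (P i)} = visits P u \<inter> {..<t}"
    by (auto simp: visits_def)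
  then show ?thesis by (simp add: visit_count_def length_filter_conv_card cong: conj_cong)
qed

text \<open>An unblocked option of least count cannot stay bounded while infinitely many walks pass
  through \<open>u\<close>; so only as many options as can be blocked at once are visited finitely often.\<close>

lemma few_neglected_if_least_visited:
  assumes inf: "infinite (visits P u)"
    and step: "\<And>t. t \<ge> start \<Longrightarrow> prefix u (P t) \<Longrightarrow> length u < length (P t) \<and>
      greedy_step (N t) (\<lambda>u. card (visits P u \<inter> {..<t})) n u (P t ! length u)"
    and const: "\<And>t. t \<ge> start \<Longrightarrow> N t u = A"
    and A: "finite A"
  shows "card {w\<in>A. finite (visits P (u @ [w]))} \<le> 2 * length u"
proof (rule ccontr)
  let ?N = "{w\<in>A. finite (visits P (u @ [w]))}"
  assume neg: "\<not> card ?N \<le> 2 * length u"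
  define q where "q = (\<Sum>w\<in>?N. card (visits P (u @ [w])))"
  have q: "card (visits P (u @ [w]) \<inter> {..<t}) \<le> q" if "w \<in> ?N" for w t
  proof -
    have "card (visits P (u @ [w]) \<inter> {..<t}) \<le> card (visits P (u @ [w]))"
      using that by (intro card_mono) auto
    also have "\<dots> \<le> q" unfolding q_def using that A by (intro member_le_sum) auto
    finally show ?thesis .
  qed
  \<comment> \<open>Whenever a walk leaves \<open>u\<close>, some neglected option is unblocked, so
    the chosen option has count at most \<open>q\<close>. Every visit to \<open>u\<close> from
    \<open>start\<close> on is thus among the first \<open>q + 1\<close> visits to one of finitely
    many options.\<close>
  have "visits P u \<subseteq> {..<start} \<union> (\<Union>x\<in>A. {t\<in>visits P (u @ [x]). card (visits P (u @ [x]) \<inter> {..<t}) \<le> q})"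
  proof
    fix t assume t: "t \<in> visits P u"
    show "t \<in> {..<start} \<union> (\<Union>x\<in>A. {t\<in>visits P (u @ [x]). card (visits P (u @ [x]) \<inter> {..<t}) \<le> q})"
    proof (cases "t < start")
      case False
      let ?x = "P t ! length u"
      have pre: "prefix u (P t)" using t by (simp add: visits_def)
      with False step have len: "length u < length (P t)"
        and gs: "greedy_step (N t) (\<lambda>u. card (visits P u \<inter> {..<t})) n u ?x" by auto
      from gs const[of t] False obtain B where B: "finite B" "card B \<le> 2 * length u" "?x \<in> A - B"
        "\<And>w'. w' \<in> A - B \<Longrightarrow> card (visits P (u @ [?x]) \<inter> {..<t}) \<le> card (visits P (u @ [w']) \<inter> {..<t})"
        unfolding greedy_step_def by auto
      have "\<not> ?N \<subseteq> B" using neg B card_mono by (metis (no_types, lifting) le_trans)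
      then obtain w where w: "w \<in> ?N" "w \<notin> B" by blast
      have "card (visits P (u @ [?x]) \<inter> {..<t}) \<le> q"
        using B(4)[of w] w q[of w t] by auto
      moreover have "t \<in> visits P (u @ [?x])"
      proof -
        have "u @ [?x] = take (Suc (length u)) (P t)"
          using pre len by (metis prefix_def take_Suc_conv_app_nth append_eq_conv_conj)
        then show ?thesis unfolding visits_def by (metis mem_Collect_eq take_is_prefix)
      qed
      ultimately show ?thesis using B(3) by blast
    qed simp
  qed
  moreover have "finite \<dots>"
    using A finite_few_predecessors by auto
  ultimately show False using inf finite_subset by blast
qed

text \<open>The game is abstracted away: \<open>v t\<close> is the leaf inserted at time
  \<open>t\<close>, \<open>P t\<close> is its walk, and options and counts at time \<open>t\<close>
  come from earlier insertions only.\<close>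

locale insertions =
  fixes Q :: "nat \<Rightarrow> nat set" and n m :: nat
    and v :: "nat \<Rightarrow> nat" and P :: "nat \<Rightarrow> nat list"
  assumes n: "n \<ge> 1"
    and m: "m > 2 * n ^ 3"
    and disj: "disjoint_family_on Q {..<n}"
    and card_Q: "\<And>j. j < n \<Longrightarrow> card (Q j) = m"
    and inj: "inj v"
    and valid: "\<And>t. maximal_greedy_path (opts Q n (map (\<lambda>i. (v i, P i)) [0..<t]))
      (visit_count (map (\<lambda>i. (v i, P i)) [0..<t])) n (P t)"
begin

abbreviation L where "L t \<equiv> map (\<lambda>i. (v i, P i)) [0..<t]"

lemma finite_Q: "j < n \<Longrightarrow> finite (Q j)"
  using card_Q m by (metis card.infinite not_less_zero)

lemma block_index_eq:
  assumes "j < n" "s \<in> Q j"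
  shows "block_index Q n s = j"
  unfolding block_index_def
proof (rule the_equality)
  fix j' assume "j' < n \<and> s \<in> Q j'"
  then show "j' = j" using assms disj by (auto simp: disjoint_family_on_def)
qed (use assms in simp)

lemma passing:
  assumes "prefix u (P t)" "2 * n * length u < card (opts Q n (L t) u)"
  shows "length u < length (P t) \<and> greedy_step (opts Q n (L t)) (visit_count (L t)) n u (P t ! length u)"
proof -
  have "P t \<noteq> u" using assms(2) valid[of t] by (auto simp: maximal_greedy_path_def)
  with assms(1) have "length u < length (P t)" "take (length u) (P t) = u"
    by (auto simp: prefix_def)
  then show ?thesis using valid[of t] by (auto simp: maximal_greedy_path_def greedy_path_def)
qed

lemma few_neglected:
  assumes "infinite (visits P u)" "\<And>t. t \<ge> start \<Longrightarrow> opts Q n (L t) u = A"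
    "2 * n * length u < card A"
  shows "card {w\<in>A. finite (visits P (u @ [w]))} \<le> 2 * length u"
proof (rule few_neglected_if_least_visited[where start = start and n = n and N = "\<lambda>t. opts Q n (L t)"])
  fix t assume "t \<ge> start" "prefix u (P t)"
  moreover have "(\<lambda>u. card (visits P u \<inter> {..<t})) = visit_count (L t)" by (simp add: fun_eq_iff visit_count_map)
  ultimately show "length u < length (P t) \<and>
      greedy_step (opts Q n (L t)) (\<lambda>u. card (visits P u \<inter> {..<t})) n u (P t ! length u)"
    using passing[of u t] assms by simp
next
  show "finite A" using assms(3) by (metis card.infinite not_less_zero)
qed (use assms in auto)

definition transversal :: "nat list \<Rightarrow> bool" where
  "transversal X \<longleftrightarrow> length X = n \<and> (\<forall>j<n. X ! j \<in> Q j)"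

lemma opts_partial:
  assumes "transversal X" "j < n" "0 < i" "i < n"
  shows "opts Q n l (take i (rotate j X)) = Q ((j + i) mod n)"
proof -
  have "X \<noteq> []" "length X = n" using assms by (auto simp: transversal_def)
  then have "hd (take i (rotate j X)) = X ! j" "take i (rotate j X) \<noteq> []"
    using assms by (auto simp: hd_rotate_conv_nth)
  moreover have "block_index Q n (X ! j) = j" using assms block_index_eq by (auto simp: transversal_def)
  ultimately show ?thesis using assms \<open>length X = n\<close> by (simp add: opts_def)
qed

text \<open>The right-hand side does not depend on \<open>j\<close>: behind \<open>X\<close>, leaves
  of all kinds meet the same options. The two rotations combine into one because
  \<open>length X = n\<close>.\<close>

lemma opts_full:
  assumes "transversal X" "j < n"
  shows "opts Q n l (rotate j X @ w) = {x. (x, rotate (length w) X @ w) \<in> set l}"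
proof -
  have len: "length X = n" and "X \<noteq> []" using assms by (auto simp: transversal_def)
  then have "hd (rotate j X @ w) = X ! j"
    using assms by (auto simp: hd_append hd_rotate_conv_nth)
  moreover have "block_index Q n (X ! j) = j" using assms block_index_eq by (auto simp: transversal_def)
  moreover have "rotate (n + length w - j) (rotate j X) = rotate (length w) X"
  proof -
    have "rotate (n + length w - j) (rotate j X) = rotate (n + length w) X"
      using assms by (simp add: rotate_rotate)
    also have "\<dots> = rotate (length w) X" using len by (metis rotate_conv_mod mod_add_self1)
    finally show ?thesis .
  qed
  ultimately show ?thesis using assms len \<open>X \<noteq> []\<close> by (simp add: opts_def)
qed

lemma infinite_visits_Nil: "infinite (visits P [])"
  by (simp add: visits_def)

text \<open>At the empty walk the bound on neglected options is \<open>0\<close>, since nothing is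
  blocked yet.\<close>

lemma infinite_visits_single:
  assumes "j < n" "s \<in> Q j"
  shows "infinite (visits P [s])"
proof -
  let ?A = "\<Union>j<n. Q j"
  have fin: "finite ?A" using finite_Q by auto
  have "card ?A > 0" using assms fin by (auto simp: card_gt_0_iff)
  then have "card {w\<in>?A. finite (visits P ([] @ [w]))} \<le> 2 * length ([]::nat list)"
    by (intro few_neglected[where start = 0] infinite_visits_Nil) (simp_all add: opts_def)
  then have "{w\<in>?A. finite (visits P [w])} = {}" using fin by simp
  then show ?thesis using assms by blast
qed

text \<open>The prefix of length \<open>i\<close> does not depend on the coordinate \<open>(j + i) mod n\<close>, which takes at most
  \<open>2 * n\<close> bad values once the other coordinates are fixed.\<close>

lemma few_bad_transversals:
  assumes "j < n" "0 < i" "i < n"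
  shows "card {f \<in> PiE {..<n} Q. infinite (visits P (take i (rotate j (map f [0..<n])))) \<and>
      finite (visits P (take (Suc i) (rotate j (map f [0..<n]))))} \<le> 2 * n * m ^ (n - 1)"
    (is "card ?bad \<le> _")
proof -
  define c where "c = (j + i) mod n"
  define U where "U f = take i (rotate j (map f [0..<n]))" for f :: "nat \<Rightarrow> nat"
  have c: "c < n" using n by (simp add: c_def)
  define G where "G = PiE ({..<n} - {c}) Q"
  \<comment> \<open>The empty default lets the bound \<open>2 * n\<close> hold also where the prefix
    is visited only finitely often.\<close>
  define N where "N f = (if infinite (visits P (U f)) then {w \<in> Q c. finite (visits P (U f @ [w]))} else {})" for f
  \<comment> \<open>\<open>U f\<close> uses the \<open>i < n\<close> coordinates from
    \<open>j\<close> on in cyclic order, and \<open>c\<close> is the one that comes next.\<close>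
  have cong: "U f = U g" if "\<And>x. x < n \<Longrightarrow> x \<noteq> c \<Longrightarrow> f x = g x" for f g
  proof (rule nth_equalityI)
    fix r assume "r < length (U f)"
    then have r: "r < i" using assms by (simp add: U_def)
    have "(j + r) mod n \<noteq> c"
    proof
      assume "(j + r) mod n = c"
      then have "n dvd i - r"
        using r mod_eq_dvd_iff_nat[of "j + r" "j + i" n] by (simp add: c_def)
      with r assms show False using nat_dvd_not_less[of "i - r" n] by simp
    qed
    then show "U f ! r = U g ! r"
      using r assms n that by (simp add: U_def nth_rotate)
  qed (simp add: U_def)
  have snoc: "take (Suc i) (rotate j (map f [0..<n])) = U f @ [f c]" for f
    using assms c by (simp add: U_def take_Suc_conv_app_nth nth_rotate c_def)
  have fin: "finite G" unfolding G_def using finite_Q by (intro finite_PiE) auto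
  have Nfin: "finite (N f)" for f using finite_Q[OF c] by (simp add: N_def)
  have N: "card (N f) \<le> 2 * n" if "f \<in> PiE {..<n} Q" for f
  proof (cases "infinite (visits P (U f))")
    case True
    have tr: "transversal (map f [0..<n])" using that by (auto simp: transversal_def)
    have len: "length (U f) = i" using assms by (simp add: U_def)
    have "2 * n * i < m"
    proof -
      have "2 * n * i \<le> 2 * n * n" using assms by simp
      also have "\<dots> \<le> 2 * n ^ 3" using n by (simp add: power3_eq_cube)
      finally show ?thesis using m by simp
    qed
    then have "card {w\<in>Q c. finite (visits P (U f @ [w]))} \<le> 2 * length (U f)"
      using True assms c tr len
      by (intro few_neglected[where start = 0]) (simp_all add: card_Q U_def opts_partial c_def)
    then show ?thesis using True assms len by (simp add: N_def)
  qed (simp add: N_def)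
  have "?bad \<subseteq> (\<Union>g\<in>G. (\<lambda>y. g(c := y)) ` N g)"
  proof
    fix f assume f: "f \<in> ?bad"
    let ?g = "f(c := undefined)"
    have "?g \<in> G" using f by (auto simp: G_def PiE_def extensional_def)
    moreover have "f c \<in> N ?g"
      using f c cong[of f ?g] snoc[of f] by (auto simp: N_def U_def[symmetric])
    moreover have "f = ?g(c := f c)" by simp
    ultimately show "f \<in> (\<Union>g\<in>G. (\<lambda>y. g(c := y)) ` N g)" by blast
  qed
  then have "card ?bad \<le> card (\<Union>g\<in>G. (\<lambda>y. g(c := y)) ` N g)"
    using fin Nfin by (intro card_mono) auto
  also have "\<dots> \<le> (\<Sum>g\<in>G. card ((\<lambda>y. g(c := y)) ` N g))"
    using fin by (rule card_UN_le)
  also have "\<dots> \<le> (\<Sum>g\<in>G. 2 * n)"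
  proof (rule sum_mono)
    fix g assume g: "g \<in> G"
    \<comment> \<open>Any value at \<open>c\<close> turns \<open>g\<close> into a full choice, and
      \<open>N\<close> ignores that value.\<close>
    obtain y where y: "y \<in> Q c" using card_Q[OF c] m by (metis card.empty ex_in_conv not_less_zero)
    have "g(c := y) \<in> PiE {..<n} Q"
      using g y c by (auto simp: G_def PiE_def extensional_def Pi_def)
    then have "card (N (g(c := y))) \<le> 2 * n" by (rule N)
    moreover have "N (g(c := y)) = N g" using cong[of g "g(c := y)"] by (simp add: N_def)
    ultimately show "card ((\<lambda>y. g(c := y)) ` N g) \<le> 2 * n"
      using card_image_le[OF Nfin] by (metis le_trans)
  qed
  also have "\<dots> = 2 * n * m ^ (n - 1)"
    using c by (simp add: G_def card_PiE card_Q)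
  finally show ?thesis .
qed

text \<open>Union bound: \<open>n\<close> starting blocks times \<open>n - 1\<close> extensions
  exclude at most \<open>n * (n - 1) * (2 * n) * m ^ (n - 1)\<close> transversals, fewer than the
  \<open>m ^ n\<close> available because \<open>m > 2 * n ^ 3\<close>.\<close>

lemma ex_visited_transversal:
  "\<exists>X. transversal X \<and> (\<forall>j<n. infinite (visits P (rotate j X)))"
proof -
  let ?bad = "\<lambda>(j, i). {f \<in> PiE {..<n} Q. infinite (visits P (take i (rotate j (map f [0..<n])))) \<and>
      finite (visits P (take (Suc i) (rotate j (map f [0..<n]))))}"
  let ?I = "{..<n} \<times> {0<..<n}"
  have "card (\<Union>x\<in>?I. ?bad x) \<le> (\<Sum>x\<in>?I. card (?bad x))"
    by (rule card_UN_le) simp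
  also have "\<dots> \<le> (\<Sum>x\<in>?I. 2 * n * m ^ (n - 1))"
    by (rule sum_mono) (use few_bad_transversals in auto)
  also have "\<dots> = n * (n - 1) * (2 * n) * m ^ (n - 1)"
    by simp
  also have "\<dots> \<le> (2 * n ^ 3) * m ^ (n - 1)"
    by (intro mult_right_mono) (simp_all add: power3_eq_cube)
  also have "\<dots> < m * m ^ (n - 1)"
    using m by simp
  also have "\<dots> = card (PiE {..<n} Q)"
    using n by (simp add: card_PiE card_Q power_eq_if)
  finally have less: "card (\<Union>x\<in>?I. ?bad x) < card (PiE {..<n} Q)" .
  have "\<not> PiE {..<n} Q \<subseteq> (\<Union>x\<in>?I. ?bad x)"
  proof
    assume sub: "PiE {..<n} Q \<subseteq> (\<Union>x\<in>?I. ?bad x)"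
    have "finite (PiE {..<n} Q)" using finite_Q by (intro finite_PiE) auto
    then have "finite (\<Union>x\<in>?I. ?bad x)" by auto
    from card_mono[OF this sub] less show False by simp
  qed
  then obtain f where f: "f \<in> PiE {..<n} Q" "f \<notin> (\<Union>x\<in>?I. ?bad x)" by blast
  have extend: "infinite (visits P (take (Suc i) (rotate j (map f [0..<n]))))"
    if "j < n" "0 < i" "i < n" "infinite (visits P (take i (rotate j (map f [0..<n]))))" for j i
  proof
    assume "finite (visits P (take (Suc i) (rotate j (map f [0..<n]))))"
    with that f(1) have "f \<in> ?bad (j, i)" by simp
    moreover have "(j, i) \<in> ?I" using that by simp
    ultimately show False using f(2) by blast
  qed
  let ?X = "map f [0..<n]"
  have tr: "transversal ?X" using f(1) by (auto simp: transversal_def)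
  have "infinite (visits P (rotate j ?X))" if j: "j < n" for j
  proof -
    have "infinite (visits P (take i (rotate j ?X)))" if "1 \<le> i" "i \<le> n" for i
      using that
    proof (induction i rule: dec_induct)
      case base
      have "take 1 (rotate j ?X) = [f j]"
        using j n by (cases "rotate j ?X") (auto simp: nth_rotate simp flip: hd_conv_nth
          dest!: arg_cong[of _ _ hd] simp: hd_rotate_conv_nth)
      moreover have "f j \<in> Q j" using f(1) j by auto
      ultimately show ?case using infinite_visits_single[OF j] by simp
    next
      case (step i)
      then show ?case using extend[OF j, of i] by simp
    qed
    from this[of n] n show ?thesis by simp
  qed
  with tr show ?thesis by blast
qed

text \<open>Leaves of kind \<open>length w mod n\<close> that stop at \<open>w\<close> become its
  children. If their number never passed the threshold, every such walk through \<open>w\<close>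
  would stop there and add one; so the threshold is passed, and then the children are fixed. Each of
  the \<open>n\<close> kinds neglects at most \<open>2 * (n + length w)\<close> of them, too few to
  cover all.\<close>

lemma ex_visited_child:
  assumes X: "transversal X" and inf: "\<And>j. j < n \<Longrightarrow> infinite (visits P (rotate j X @ w))"
  shows "\<exists>t. P t = rotate (length w) X @ w \<and> (\<forall>j<n. infinite (visits P (rotate j X @ w @ [v t])))"
proof -
  define d where "d = length w"
  define u where "u = rotate d X @ w"
  define A where "A t = {v t' | t'. t' < t \<and> P t' = u}" for t
  have len: "length X = n" "length u = n + d" using X by (simp_all add: transversal_def u_def d_def)
  have optsA: "opts Q n (L t) (rotate j X @ w) = A t" if "j < n" for t j
    unfolding opts_full[OF X that] A_def u_def d_def by auto
  have u: "u = rotate (d mod n) X @ w" unfolding u_def using len by (metis rotate_conv_mod)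
  have dn: "d mod n < n" using n by simp
  have finA: "finite (A t)" for t unfolding A_def by simp
  have monoA: "A s \<subseteq> A t" if "s \<le> t" for s t using that unfolding A_def by fastforce
  have stop: "length u < length (P t)" if "prefix u (P t)" "2 * n * (n + d) < card (A t)" for t
    using passing[OF that(1)] that(2) optsA[OF dn] by (simp add: u[symmetric] len)
  have "\<exists>start. 2 * n * (n + d) < card (A start)"
  proof (rule ccontr)
    let ?V = "{t. P t = u}"
    assume neg: "\<nexists>start. 2 * n * (n + d) < card (A start)"
    have "P t = u" if "prefix u (P t)" for t
    proof (rule ccontr)
      assume "P t \<noteq> u"
      with that have "length u < length (P t)" "take (length u) (P t) = u"
        by (auto simp: prefix_def)
      then have "greedy_step (opts Q n (L t)) (visit_count (L t)) n u (P t ! length u)"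
        using valid[of t] by (auto simp: maximal_greedy_path_def greedy_path_def)
      then show False using neg optsA[OF dn] by (auto simp: greedy_step_def u[symmetric] len)
    qed
    then have "visits P u \<subseteq> ?V" by (auto simp: visits_def)
    with inf[OF dn] have "infinite ?V" using u finite_subset by metis
    then obtain F where F: "finite F" "card F = Suc (2 * n * (n + d))" "F \<subseteq> ?V"
      using infinite_arbitrarily_large by blast
    have "v ` F \<subseteq> A (Suc (Max F))"
      using F by (auto simp: A_def less_Suc_eq_le)
    then have "card F \<le> card (A (Suc (Max F)))"
      using finA inj by (metis card_image card_mono inj_on_subset subset_UNIV)
    with F neg show False by (metis Suc_le_eq)
  qed
  then obtain start where start: "2 * n * (n + d) < card (A start)" ..
  have big: "2 * n * (n + d) < card (A t)" if "t \<ge> start" for t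
    using start card_mono[OF finA monoA[OF that]] by linarith
  have const: "A t = A start" if "t \<ge> start" for t
  proof -
    have "t' < start" if "P t' = u" for t'
      using stop[of t'] big[of t'] that by (metis leI less_irrefl prefix_order.refl)
    then show ?thesis using that unfolding A_def by (metis order_less_le_trans)
  qed
  have few: "card {x\<in>A start. finite (visits P ((rotate j X @ w) @ [x]))} \<le> 2 * (n + d)" if j: "j < n" for j
  proof -
    have "card {x\<in>A start. finite (visits P ((rotate j X @ w) @ [x]))} \<le> 2 * length (rotate j X @ w)"
    proof (rule few_neglected[OF inf[OF j]])
      show "opts Q n (L t) (rotate j X @ w) = A start" if "t \<ge> start" for t
        unfolding optsA[OF j] by (rule const[OF that])
      show "2 * n * length (rotate j X @ w) < card (A start)"
        using start len by (simp add: d_def)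
    qed
    then show ?thesis using len by (simp add: d_def)
  qed
  have "\<exists>x\<in>A start. \<forall>j<n. infinite (visits P (rotate j X @ w @ [x]))"
  proof (rule ccontr)
    assume "\<not> ?thesis"
    then have "A start \<subseteq> (\<Union>j<n. {x\<in>A start. finite (visits P ((rotate j X @ w) @ [x]))})" by auto
    then have "card (A start) \<le> card (\<Union>j<n. {x\<in>A start. finite (visits P ((rotate j X @ w) @ [x]))})"
      using finA by (intro card_mono) auto
    also have "\<dots> \<le> (\<Sum>j<n. card {x\<in>A start. finite (visits P ((rotate j X @ w) @ [x]))})"
      by (rule card_UN_le) simp
    also have "\<dots> \<le> (\<Sum>j<n. 2 * (n + d))"
      by (rule sum_mono) (use few in auto)
    finally show False using start by (simp add: algebra_simps)
  qed
  then obtain x where x: "x \<in> A start" "\<forall>j<n. infinite (visits P (rotate j X @ w @ [x]))" ..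
  from x(1) obtain t where "x = v t" "P t = u" unfolding A_def by blast
  with x(2) have "P t = rotate (length w) X @ w" "\<forall>j<n. infinite (visits P (rotate j X @ w @ [v t]))"
    by (simp_all only: u_def d_def)
  then show ?thesis by (intro exI conjI)
qed

text \<open>\<open>w d\<close> was inserted by a walk through all of \<open>X\<close> and all
  earlier \<open>w e\<close>, so it is joined to them; the rotation by \<open>d\<close> makes
  \<open>X ! (d mod n)\<close> the centre at which that walk began.\<close>

theorem ex_infinite_branch:
  "\<exists>X w. transversal X \<and> (\<forall>d. \<exists>t. v t = w d \<and> P t = rotate d X @ map w [0..<d])"
proof -
  from ex_visited_transversal obtain X where X: "transversal X"
    and inf: "\<And>j. j < n \<Longrightarrow> infinite (visits P (rotate j X))" by blast
  have "\<exists>W. \<forall>d. (length (W d) = d \<and> (\<forall>j<n. infinite (visits P (rotate j X @ W d)))) \<and>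
    (\<exists>t. P t = rotate d X @ W d \<and> W (Suc d) = W d @ [v t])"
  proof (rule dependent_nat_choice)
    show "\<exists>x. length x = 0 \<and> (\<forall>j<n. infinite (visits P (rotate j X @ x)))" using inf by simp
  next
    fix w d assume w: "length w = d \<and> (\<forall>j<n. infinite (visits P (rotate j X @ w)))"
    with ex_visited_child[OF X, of w] obtain t where
      "P t = rotate d X @ w" "\<forall>j<n. infinite (visits P (rotate j X @ w @ [v t]))" by auto
    with w show "\<exists>y. (length y = Suc d \<and> (\<forall>j<n. infinite (visits P (rotate j X @ y)))) \<and>
        (\<exists>t. P t = rotate d X @ w \<and> y = w @ [v t])"
      by (intro exI[of _ "w @ [v t]"]) auto
  qed
  then obtain W where W: "\<And>d. length (W d) = d"
    "\<And>d. \<exists>t. P t = rotate d X @ W d \<and> W (Suc d) = W d @ [v t]" by metis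
  define w where "w d = last (W (Suc d))" for d
  have snoc: "W (Suc d) = W d @ [w d]" for d using W(2)[of d] by (auto simp: w_def)
  have "W d = map w [0..<d]" for d
    by (induction d) (use W(1)[of 0] snoc in auto)
  then have "\<exists>t. v t = w d \<and> P t = rotate d X @ map w [0..<d]" for d
    using W(2)[of d] snoc[of d] by auto
  with X show ?thesis by blast
qed

end

section \<open>Inserting leaves\<close>

lemma greedy_path_snoc:
  "greedy_path N c n P \<Longrightarrow> greedy_step N c n P w \<Longrightarrow> greedy_path N c n (P @ [w])"
  by (auto simp: greedy_path_def less_Suc_eq nth_append)

text \<open>The bound on claimed edges at \<open>v\<close> survives a step, as a round adds one edge
  of Maker and at most one of Breaker there; it supplies the blocked set of
  \<open>greedy_step\<close>. The walk ends because there are no options beyond length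
  \<open>b\<close>.\<close>

lemma force_greedy_path:
  assumes "n \<ge> 1" "\<And>u. v \<notin> N u" "\<And>u. length u > b \<Longrightarrow> N u = {}"
    and "position h" "even (length h)" "greedy_path N c n P"
      "card {e\<in>set h. v \<in> e} \<le> 2 * length P" "\<forall>w\<in>set P. {v, w} \<in> maker_claimed h"
  shows "force (\<lambda>h'. \<exists>P'. prefix P P' \<and> maximal_greedy_path N c n P' \<and>
    (\<forall>w\<in>set P'. {v, w} \<in> maker_claimed h')) h"
  using assms(4-)
proof (induction "Suc b - length P" arbitrary: P h rule: less_induct)
  case less
  show ?case
  proof (cases "card (N P) \<le> 2 * n * length P")
    case True
    then show ?thesis using less.prems
      by (intro force.now exI[of _ P]) (auto simp: maximal_greedy_path_def)
  next
    case False
    define B where "B = {w. {v, w} \<in> set h}"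
    have B: "finite B" "card B \<le> 2 * length P"
      unfolding B_def using card_star_le[of "set h" v] less.prems(4) by auto
    have "2 * length P \<le> 2 * n * length P" using assms(1) by simp
    with False B(2) have "card B < card (N P)" by linarith
    then have "\<not> N P \<subseteq> B" using B(1) by (metis card_mono linorder_not_less)
    then obtain w0 where "w0 \<in> N P - B" by blast
    then obtain w where w: "w \<in> N P - B" "\<And>w'. w' \<in> N P - B \<Longrightarrow> c (P @ [w]) \<le> c (P @ [w'])"
      using ex_has_least_nat[of "\<lambda>w. w \<in> N P - B" w0 "\<lambda>w. c (P @ [w])"] by blast
    have step: "greedy_step N c n P w"
      using False B w unfolding greedy_step_def by (intro conjI exI[of _ B]) auto
    have "length P \<le> b" using w(1) assms(3)[of P] by (metis Diff_iff empty_iff linorder_not_le)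
    have "v \<noteq> w" using w(1) assms(2) by blast
    show ?thesis
    proof (rule force.move)
      show e: "{v, w} \<in> edges K_aleph0 - set h"
        using w(1) \<open>v \<noteq> w\<close> by (simp add: B_def edge_K_aleph0_iff)
      fix f assume f: "f \<in> edges K_aleph0 - set (h @ [{v, w}])"
      let ?h = "h @ [{v, w}, f]"
      have "force (\<lambda>h'. \<exists>P'. prefix (P @ [w]) P' \<and> maximal_greedy_path N c n P' \<and>
        (\<forall>w\<in>set P'. {v, w} \<in> maker_claimed h')) ?h"
      proof (rule less.hyps)
        show "Suc b - length (P @ [w]) < Suc b - length P" using \<open>length P \<le> b\<close> by simp
        show "position ?h" "even (length ?h)" using e f less.prems by (auto simp: position_def)
        show "greedy_path N c n (P @ [w])" using less.prems step by (intro greedy_path_snoc)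
        have "{e\<in>set ?h. v \<in> e} \<subseteq> insert {v, w} (insert f {e\<in>set h. v \<in> e})" by auto
        then have "card {e\<in>set ?h. v \<in> e} \<le> card (insert {v, w} (insert f {e\<in>set h. v \<in> e}))"
          by (intro card_mono) auto
        also have "\<dots> \<le> Suc (Suc (card {e\<in>set h. v \<in> e}))"
          by (metis (no_types, lifting) card_insert_le_m1 diff_Suc_1 le_refl zero_less_Suc)
        finally show "card {e\<in>set ?h. v \<in> e} \<le> 2 * length (P @ [w])" using less.prems(4) by simp
        show "\<forall>w\<in>set (P @ [w]). {v, w} \<in> maker_claimed ?h"
          using less.prems by (auto simp: maker_claimed_append_two)
      qed
      then show "force (\<lambda>h'. \<exists>P'. prefix P P' \<and> maximal_greedy_path N c n P' \<and>
        (\<forall>w\<in>set P'. {v, w} \<in> maker_claimed h')) ?h"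
        by (rule force_trans) (auto intro!: force.now dest: append_prefixD)
    qed
  qed
qed

definition insertion :: "(nat \<Rightarrow> nat set) \<Rightarrow> nat \<Rightarrow> (nat \<Rightarrow> nat set) \<Rightarrow> (nat \<times> nat list) list \<Rightarrow>
    nat \<Rightarrow> nat list \<Rightarrow> nat set set \<Rightarrow> bool" where
  "insertion Q n Lv l v P M \<longleftrightarrow> P \<noteq> [] \<and> v \<in> Lv (hd P) \<and> v \<notin> fst ` set l \<and>
     maximal_greedy_path (opts Q n l) (visit_count l) n P \<and> (\<forall>w\<in>set P. {v, w} \<in> M)"

lemma force_insertion:
  assumes n: "n \<ge> 1" and pos: "position h" "even (length h)"
    and fin: "\<And>j. j < n \<Longrightarrow> finite (Q j)" and ne: "Q 0 \<noteq> {}"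
    and inf: "\<And>s j. j < n \<Longrightarrow> s \<in> Q j \<Longrightarrow> infinite (Lv s) \<and> Lv s \<inter> (\<Union>j<n. Q j) = {}"
    and block_index: "\<And>j s. j < n \<Longrightarrow> s \<in> Q j \<Longrightarrow> block_index Q n s = j"
  shows "force (\<lambda>h'. length h < length h' \<and> (\<exists>v P. insertion Q n Lv l v P (maker_claimed h'))) h"
proof -
  let ?A = "\<Union>j<n. Q j"
  have "?A \<noteq> {}" using n ne by auto
  then obtain s0 where "s0 \<in> ?A" by blast
  \<comment> \<open>The first step is taken before the leaf is known: the own centre is chosen by
    least count, and only then an untouched leaf of it.\<close>
  then obtain s where s: "s \<in> ?A" "\<And>s'. s' \<in> ?A \<Longrightarrow> visit_count l [s] \<le> visit_count l [s']"
    using ex_has_least_nat[of "\<lambda>w. w \<in> ?A" s0 "\<lambda>w. visit_count l [w]"] by blast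
  have finA: "finite ?A" using fin by auto
  have "\<forall>e\<in>set h. finite e"
    using pos(1) by (auto simp: position_def elim!: edges_K_aleph0_cases dest!: subsetD)
  then have "finite (fst ` set l \<union> \<Union>(set h))" by auto
  moreover have "infinite (Lv s)" using s(1) inf by blast
  ultimately obtain v where v: "v \<in> Lv s" "v \<notin> fst ` set l" "v \<notin> \<Union>(set h)"
    by (metis UnI1 UnI2 finite_subset subsetI)
  have vA: "v \<notin> ?A" using s(1) inf v(1) by blast
  \<comment> \<open>Behind the blocks, options are recorded by walks of the same length, so none
    exist beyond the recorded lengths.\<close>
  obtain b0 where b0: "\<And>P. P \<in> snd ` set l \<Longrightarrow> length P \<le> b0"
    using finite_nat_set_iff_bounded_le[of "length ` snd ` set l"] by auto
  show ?thesis
  proof (rule force.move)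
    have "v \<noteq> s" using s(1) vA by blast
    then show e: "{v, s} \<in> edges K_aleph0 - set h" using v(3) by (auto simp: edge_K_aleph0_iff)
    fix f assume f: "f \<in> edges K_aleph0 - set (h @ [{v, s}])"
    let ?h = "h @ [{v, s}, f]"
    have pos': "position ?h" "even (length ?h)" using e f pos by (auto simp: position_def)
    have "force (\<lambda>h'. \<exists>P'. prefix [s] P' \<and> maximal_greedy_path (opts Q n l) (visit_count l) n P' \<and>
      (\<forall>w\<in>set P'. {v, w} \<in> maker_claimed h')) ?h"
    proof (rule force_greedy_path[OF n _ _ pos'])
      show "v \<notin> opts Q n l u" for u
      proof
        assume "v \<in> opts Q n l u"
        moreover have "(block_index Q n (hd u) + length u) mod n < n" using n by simp
        ultimately show False using v(2) vA by (force simp: opts_def split: if_splits)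
      qed
      show "opts Q n l u = {}" if "length u > n + b0" for u
      proof -
        have "length P \<noteq> length u" if "(x, P) \<in> set l" for x P
          using b0[of P] that \<open>length u > n + b0\<close> by force
        moreover have "length (rotate k (take n u) @ drop n u) = length u" for k by simp
        ultimately show ?thesis using that by (auto simp: opts_def simp del: length_append length_rotate)
      qed
      have "greedy_step (opts Q n l) (visit_count l) n [] s"
        using s finA \<open>?A \<noteq> {}\<close> by (auto simp: greedy_step_def opts_def card_gt_0_iff intro!: exI[of _ "{}"])
      then show "greedy_path (opts Q n l) (visit_count l) n [s]" by (simp add: greedy_path_def)
      have "{e\<in>set ?h. v \<in> e} \<subseteq> {{v, s}, f}" using v(3) by auto
      then have "card {e\<in>set ?h. v \<in> e} \<le> card {{v, s}, f}" by (intro card_mono) auto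
      also have "\<dots> \<le> 2" by (simp add: card_insert_if)
      finally show "card {e\<in>set ?h. v \<in> e} \<le> 2 * length [s]" by simp
      show "\<forall>w\<in>set [s]. {v, w} \<in> maker_claimed ?h" using pos by (simp add: maker_claimed_append_two)
    qed
    from this pos' show "force (\<lambda>h'. length h < length h' \<and> (\<exists>v P. insertion Q n Lv l v P (maker_claimed h'))) ?h"
    proof (rule force_then)
      fix h' assume "\<exists>P'. prefix [s] P' \<and> maximal_greedy_path (opts Q n l) (visit_count l) n P' \<and>
        (\<forall>w\<in>set P'. {v, w} \<in> maker_claimed h')" and pre: "prefix ?h h'"
      then obtain P where P: "prefix [s] P" "maximal_greedy_path (opts Q n l) (visit_count l) n P"
        "\<forall>w\<in>set P. {v, w} \<in> maker_claimed h'" by blast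
      have "P \<noteq> []" "hd P = s" using P(1) by (auto simp: prefix_def)
      then have "insertion Q n Lv l v P (maker_claimed h')" using P v by (auto simp: insertion_def)
      moreover have "length h < length h'" using pre by (auto dest: prefix_length_le)
      ultimately show "force (\<lambda>h'. length h < length h' \<and> (\<exists>v P. insertion Q n Lv l v P (maker_claimed h'))) h'"
        by (intro force.now) blast
    qed
  qed
qed

section \<open>Blocks of a clique transversal\<close>

definition block :: "nat \<Rightarrow> nat list \<Rightarrow> nat \<Rightarrow> nat set" where
  "block m xs j = (\<lambda>r. xs ! (j * m + r)) ` {..<m}"

definition clique_transversal :: "nat set list \<Rightarrow> nat set set \<Rightarrow> nat list \<Rightarrow> bool" where
  "clique_transversal As M xs \<longleftrightarrow> list_all2 (\<in>) xs As \<and>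
     (\<forall>i<length xs. \<forall>j<i. xs ! j \<noteq> xs ! i \<and> {xs ! j, xs ! i} \<in> M)"

lemma maker_claimed_play_subset: "maker_claimed (map p [0..<k]) \<subseteq> maker_edges p"
  by (auto simp: maker_claimed_def maker_edges_def)

lemma maker_claimed_distinct: "position h \<Longrightarrow> {x, y} \<in> maker_claimed h \<Longrightarrow> x \<noteq> y"
  using maker_claimed_subset_set by (metis edge_K_aleph0_iff position_def subsetD)

lemma index_bound:
  fixes j m n r :: nat
  assumes "j < n" "r < m"
  shows "j * m + r < n * m"
proof -
  have "j * m + r < Suc j * m" using assms by simp
  also have "\<dots> \<le> n * m" using assms by (intro mult_right_mono) auto
  finally show ?thesis .
qed

lemma clique_transversal_inj:
  assumes "clique_transversal As M xs"
  shows "inj_on ((!) xs) {..<length xs}"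
  by (rule linorder_inj_onI) (use assms in \<open>auto simp: clique_transversal_def\<close>)

context
  fixes As :: "nat set list" and M :: "nat set set" and xs :: "nat list" and n m :: nat
  assumes ct: "clique_transversal As M xs" and len: "length As = n * m"
begin

lemma length_transversal: "length xs = n * m"
  using ct len by (auto simp: clique_transversal_def list_all2_lengthD)

lemma block_memE:
  assumes "s \<in> block m xs j" "j < n"
  obtains r where "r < m" "s = xs ! (j * m + r)" "j * m + r < n * m" "s \<in> As ! (j * m + r)"
proof -
  from assms(1) obtain r where r: "r < m" "s = xs ! (j * m + r)" by (auto simp: block_def)
  moreover have "j * m + r < n * m" using assms(2) r(1) by (rule index_bound)
  moreover from this have "s \<in> As ! (j * m + r)"
    using ct length_transversal r by (auto simp: clique_transversal_def list_all2_conv_all_nth)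
  ultimately show thesis using that by blast
qed

lemma block_subset: "j < n \<Longrightarrow> block m xs j \<subseteq> \<Union>(set As)"
  using len by (metis Union_iff block_memE nth_mem subsetI)

lemma card_block:
  assumes "j < n"
  shows "card (block m xs j) = m"
proof -
  have "inj_on (\<lambda>r. xs ! (j * m + r)) {..<m}"
  proof (rule inj_onI)
    fix r r' assume r: "r \<in> {..<m}" "r' \<in> {..<m}" and eq: "xs ! (j * m + r) = xs ! (j * m + r')"
    have "j * m + r \<in> {..<length xs}" "j * m + r' \<in> {..<length xs}"
      using r index_bound[OF assms] by (simp_all add: length_transversal)
    with inj_onD[OF clique_transversal_inj[OF ct] eq] show "r = r'" by simp
  qed
  then show ?thesis by (simp add: block_def card_image)
qed

lemma disjoint_block: "disjoint_family_on (block m xs) {..<n}"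
  unfolding disjoint_family_on_def
proof (intro ballI impI)
  fix i j assume ij: "i \<in> {..<n}" "j \<in> {..<n}" "i \<noteq> j"
  show "block m xs i \<inter> block m xs j = {}"
  proof (rule ccontr)
    assume "block m xs i \<inter> block m xs j \<noteq> {}"
    then obtain s where s: "s \<in> block m xs i" "s \<in> block m xs j" by blast
    obtain r where r: "r < m" "s = xs ! (i * m + r)" "i * m + r < n * m"
      using s(1) ij(1) by (auto elim: block_memE)
    obtain r' where r': "r' < m" "s = xs ! (j * m + r')" "j * m + r' < n * m"
      using s(2) ij(2) by (auto elim: block_memE)
    have "i * m + r = j * m + r'"
      using r r' inj_onD[OF clique_transversal_inj[OF ct], of "i * m + r" "j * m + r'"]
      by (simp add: length_transversal)
    then have "(i * m + r) div m = (j * m + r') div m" by simp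
    then show False using r(1) r'(1) ij(3) by simp
  qed
qed

lemma block_clique:
  assumes "i < n" "j < n" "i \<noteq> j" "x \<in> block m xs i" "y \<in> block m xs j"
  shows "{x, y} \<in> M"
proof -
  obtain r where r: "r < m" "x = xs ! (i * m + r)" "i * m + r < n * m"
    using assms by (auto elim: block_memE)
  obtain r' where r': "r' < m" "y = xs ! (j * m + r')" "j * m + r' < n * m"
    using assms by (auto elim: block_memE)
  have "x \<noteq> y" using assms disjoint_block by (auto simp: disjoint_family_on_def)
  then have "i * m + r \<noteq> j * m + r'" using r r' by auto
  then show ?thesis
    using ct r r' unfolding clique_transversal_def length_transversal
    by (metis insert_commute linorder_neqE_nat)
qed

lemma block_index_block: "j < n \<Longrightarrow> s \<in> block m xs j \<Longrightarrow> block_index (block m xs) n s = j"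
  unfolding block_index_def using disjoint_block
  by (intro the_equality) (auto simp: disjoint_family_on_def)

end

text \<open>The sets \<open>As ! (j * m + r)\<close> with \<open>r < m\<close> supply block
  \<open>j\<close>. Every centre of \<open>X\<close> receives the leaves \<open>w d\<close> of a
  whole residue class of indices, hence infinitely many.\<close>

theorem ex_strategy_for_leaves:
  assumes n: "n \<ge> 1" and m: "m > 2 * n ^ 3" and len: "length As = n * m"
    and large: "\<And>A. A \<in> set As \<Longrightarrow> finite A \<and> (33 * (n * m) ^ 3) ^ (n * m) \<le> card A"
    and leaves: "\<And>s. s \<in> \<Union>(set As) \<Longrightarrow> infinite (Lv s) \<and> Lv s \<inter> \<Union>(set As) = {}"
  shows "\<exists>\<sigma>. maker_strategy \<sigma> \<and> (\<forall>p. play p \<and> follows \<sigma> p \<longrightarrow>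
    (\<exists>X w. length X = n \<and> (\<forall>j<n. \<exists>r<m. X ! j \<in> As ! (j * m + r)) \<and>
      (\<forall>i<n. \<forall>j<n. i \<noteq> j \<longrightarrow> {X ! i, X ! j} \<in> maker_edges p) \<and>
      (\<forall>d. w d \<in> Lv (X ! (d mod n)) \<and> (\<forall>x\<in>set X. {w d, x} \<in> maker_edges p) \<and>
        (\<forall>e<d. {w d, w e} \<in> maker_edges p))))"
proof -
  \<comment> \<open>\<open>None\<close> is the state before the clique exists;
    \<open>Some (xs, l)\<close> holds the clique and the insertions made so far, in order.\<close>
  define Inv :: "(nat list \<times> (nat \<times> nat list) list) option \<times> nat set list \<Rightarrow> bool" where
    "Inv = (\<lambda>(s, h). case s of None \<Rightarrow> h = [] | Some (xs, l) \<Rightarrow> clique_transversal As (maker_claimed h) xs)"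
  define R :: "(nat list \<times> (nat \<times> nat list) list) option \<times> nat set list \<Rightarrow>
      (nat list \<times> (nat \<times> nat list) list) option \<times> nat set list \<Rightarrow> bool" where
    "R = (\<lambda>(s, h) (s', h'). case s of None \<Rightarrow> (\<exists>xs. s' = Some (xs, []))
      | Some (xs, l) \<Rightarrow> \<exists>v P. s' = Some (xs, l @ [(v, P)]) \<and> insertion (block m xs) n Lv l v P (maker_claimed h'))"
  have "2 * n ^ 3 \<ge> 2" using n by simp
  then have m2: "m > 2" using m by linarith
  have "\<exists>\<sigma>. maker_strategy \<sigma> \<and> (\<forall>p. play p \<and> follows \<sigma> p \<longrightarrow>
    (\<exists>c. c 0 = (None, []) \<and> (\<forall>i. (R (c i) (c (Suc i)) \<and> Inv (c (Suc i))) \<and>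
      (\<exists>k. even k \<and> snd (c i) = map p [0..<k]))))"
  \<comment> \<open>\<open>checkpoint_strategy\<close> reports the relation but not the invariant,
    so the invariant of the new state is made part of the relation.\<close>
  proof (rule checkpoint_strategy[where Inv = Inv and R = "\<lambda>c c'. R c c' \<and> Inv c'"])
    show "Inv (None, [])" by (simp add: Inv_def)
    fix s h assume I: "Inv (s, h)" and pos: "position h" "even (length h)"
    show "force (\<lambda>h'. length h < length h' \<and>
      (\<exists>s'. (R (s, h) (s', h') \<and> Inv (s', h')) \<and> Inv (s', h'))) h"
    proof (cases s)
      case None
      then have "h = []" using I by (simp add: Inv_def)
      have "force (\<lambda>h'. \<exists>xs. list_all2 (\<in>) xs As \<and>
        (\<forall>i<length xs. \<forall>j<i. {xs ! j, xs ! i} \<in> maker_claimed h')) h"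
        using large len \<open>h = []\<close> by (intro force_clique[where N = "n * m"] pos) auto
      then show ?thesis
      proof (rule force_then[OF _ pos])
        fix h' assume "\<exists>xs. list_all2 (\<in>) xs As \<and> (\<forall>i<length xs. \<forall>j<i. {xs ! j, xs ! i} \<in> maker_claimed h')"
          and "position h'"
        then obtain xs where xs: "clique_transversal As (maker_claimed h') xs"
          using maker_claimed_distinct unfolding clique_transversal_def by meson
        \<comment> \<open>A checkpoint must lie strictly later; a clique on at least two vertices
          shows that a move was made.\<close>
        have "1 * m \<le> n * m" using n by (rule mult_right_mono) simp
        then have "1 < length xs" using m2 unfolding length_transversal[OF xs len] by linarith
        with xs have "maker_claimed h' \<noteq> {}" unfolding clique_transversal_def by blast
        then have "h' \<noteq> []" by (auto simp: maker_claimed_def)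
        then show "force (\<lambda>h'. length h < length h' \<and>
          (\<exists>s'. (R (s, h) (s', h') \<and> Inv (s', h')) \<and> Inv (s', h'))) h'"
          using None xs \<open>h = []\<close>
          by (intro force.now conjI exI[of _ "Some (xs, [])"]) (auto simp: R_def Inv_def)
      qed
    next
      case (Some sl)
      obtain xs l where sl: "sl = (xs, l)" by (cases sl)
      have xs: "clique_transversal As (maker_claimed h) xs" using I Some sl by (simp add: Inv_def)
      have sub: "(\<Union>j<n. block m xs j) \<subseteq> \<Union>(set As)"
        using block_subset[OF xs len] by blast
      have "force (\<lambda>h'. length h < length h' \<and>
        (\<exists>v P. insertion (block m xs) n Lv l v P (maker_claimed h'))) h"
      proof (rule force_insertion[OF n pos])
        show "block m xs 0 \<noteq> {}" using m2 by (auto simp: block_def)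
        show "infinite (Lv s) \<and> Lv s \<inter> (\<Union>j<n. block m xs j) = {}" if "j < n" "s \<in> block m xs j" for s j
          using leaves[of s] sub that by blast
        show "block_index (block m xs) n s = j" if "j < n" "s \<in> block m xs j" for j s
          using block_index_block[OF xs len] that by blast
      qed (simp add: block_def)
      then show ?thesis
      proof (rule force_then[OF _ pos])
        fix h' assume h': "length h < length h' \<and> (\<exists>v P. insertion (block m xs) n Lv l v P (maker_claimed h'))"
          and pre: "prefix h h'"
        then obtain v P where vP: "insertion (block m xs) n Lv l v P (maker_claimed h')" by blast
        have "clique_transversal As (maker_claimed h') xs"
          using xs maker_claimed_mono_prefix[OF pre] unfolding clique_transversal_def by blast
        then show "force (\<lambda>h'. length h < length h' \<and>
          (\<exists>s'. (R (s, h) (s', h') \<and> Inv (s', h')) \<and> Inv (s', h'))) h'"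
          using h' vP Some sl
          by (intro force.now conjI exI[of _ "Some (xs, l @ [(v, P)])"]) (auto simp: R_def Inv_def)
      qed
    qed
  qed
  then obtain \<sigma> where \<sigma>: "maker_strategy \<sigma>" and run: "\<forall>p. play p \<and> follows \<sigma> p \<longrightarrow>
    (\<exists>c. c 0 = (None, []) \<and> (\<forall>i. (R (c i) (c (Suc i)) \<and> Inv (c (Suc i))) \<and>
      (\<exists>k. even k \<and> snd (c i) = map p [0..<k])))"
    by (elim exE conjE) (rule that)
  show ?thesis
  proof (intro exI[of _ \<sigma>] conjI \<sigma> allI impI)
    fix p assume "play p \<and> follows \<sigma> p"
    from run[THEN spec, THEN mp, OF this] obtain c where c0: "c 0 = (None, [])"
      and c: "\<forall>i. (R (c i) (c (Suc i)) \<and> Inv (c (Suc i))) \<and>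
        (\<exists>k. even k \<and> snd (c i) = map p [0..<k])"
      by (elim exE conjE) (rule that)
    note cR = c[THEN spec, THEN conjunct1, THEN conjunct1]
      and cI = c[THEN spec, THEN conjunct1, THEN conjunct2]
    have cp: "\<exists>k. snd (c i) = map p [0..<k]" for i
      using c[THEN spec, THEN conjunct2] by blast
    have mkp: "maker_claimed (snd (c i)) \<subseteq> maker_edges p" for i
      using cp[of i] maker_claimed_play_subset by metis
    obtain xs where c1: "fst (c (Suc 0)) = Some (xs, [])"
      using cR[of 0] c0 by (auto simp: R_def split: prod.splits)
    have ex: "\<exists>l. fst (c (Suc t)) = Some (xs, l)" for t
    proof (induction t)
      case (Suc t)
      then show ?case using cR[of "Suc t"] by (auto simp: R_def split: prod.splits)
    qed (use c1 in blast)
    define l where "l t = snd (the (fst (c (Suc t))))" for t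
    have l: "fst (c (Suc t)) = Some (xs, l t)" for t using ex[of t] by (auto simp: l_def)
    have "\<exists>v P. l (Suc t) = l t @ [(v, P)] \<and>
      insertion (block m xs) n Lv (l t) v P (maker_edges p)" for t
      using cR[of "Suc t"] l[of t] l[of "Suc t"] mkp[of "Suc (Suc t)"]
      by (auto simp: R_def insertion_def subset_iff split: prod.splits)
    then obtain v P where vP: "\<And>t. l (Suc t) = l t @ [(v t, P t)]"
      "\<And>t. insertion (block m xs) n Lv (l t) (v t) (P t) (maker_edges p)" by metis
    have lmap: "l t = map (\<lambda>i. (v i, P i)) [0..<t]" for t
      by (induction t) (use l[of 0] c1 vP(1) in auto)
    have xs: "clique_transversal As (maker_edges p) xs"
      using cI[of 0] c1 mkp[of "Suc 0"]
      by (cases "c (Suc 0)") (auto simp: Inv_def clique_transversal_def)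
    interpret insertions "block m xs" n m v P
    proof
      show "inj v"
      proof (rule linorder_injI)
        fix s t :: nat assume "s < t"
        then have "v s \<in> fst ` set (l t)" unfolding lmap by force
        moreover have "v t \<notin> fst ` set (l t)" using vP(2)[of t] unfolding insertion_def by blast
        ultimately show "v s \<noteq> v t" by metis
      qed
      show "maximal_greedy_path (opts (block m xs) n (map (\<lambda>i. (v i, P i)) [0..<t]))
        (visit_count (map (\<lambda>i. (v i, P i)) [0..<t])) n (P t)" for t
        using vP(2)[of t] by (simp add: insertion_def lmap)
    qed (use n m card_block[OF xs len] disjoint_block[OF xs len] in auto)
    obtain X w where X: "transversal X"
      and w: "\<And>d. \<exists>t. v t = w d \<and> P t = rotate d X @ map w [0..<d]"
      using ex_infinite_branch by blast
    have lenX: "length X = n" "\<And>j. j < n \<Longrightarrow> X ! j \<in> block m xs j"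
      using X by (auto simp: transversal_def)
    have "\<exists>r<m. X ! j \<in> As ! (j * m + r)" if "j < n" for j
      using lenX(2)[OF that] that by (auto elim!: block_memE[OF xs len])
    moreover have "{X ! i, X ! j} \<in> maker_edges p" if "i < n" "j < n" "i \<noteq> j" for i j
      using block_clique[OF xs len that] lenX(2) that by blast
    moreover have "w d \<in> Lv (X ! (d mod n)) \<and> (\<forall>x\<in>set X. {w d, x} \<in> maker_edges p) \<and>
        (\<forall>e<d. {w d, w e} \<in> maker_edges p)" for d
    proof -
      obtain t where t: "v t = w d" "P t = rotate d X @ map w [0..<d]" using w by blast
      have "X \<noteq> []" using lenX n by auto
      then have "hd (P t) = X ! (d mod n)" using t lenX by (simp add: hd_append hd_rotate_conv_nth)
      with vP(2)[of t] t show ?thesis by (auto simp: insertion_def)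
    qed
    ultimately show "\<exists>X w. length X = n \<and> (\<forall>j<n. \<exists>r<m. X ! j \<in> As ! (j * m + r)) \<and>
      (\<forall>i<n. \<forall>j<n. i \<noteq> j \<longrightarrow> {X ! i, X ! j} \<in> maker_edges p) \<and>
      (\<forall>d. w d \<in> Lv (X ! (d mod n)) \<and> (\<forall>x\<in>set X. {w d, x} \<in> maker_edges p) \<and>
        (\<forall>e<d. {w d, w e} \<in> maker_edges p))"
      using lenX(1) by blast
  qed
qed

section \<open>Stars\<close>

lemma is_copy_S_aleph0D:
  assumes "is_copy S_aleph0 F"
  obtains c where "c \<in> verts F" "infinite (verts F)" "edges F = {{c, y} | y. y \<in> verts F - {c}}"
proof -
  obtain f where f: "bij_betw f (UNIV::nat set) (verts F)"
    "edges F = (\<lambda>e. f ` e) ` {{0, n} | n. n \<noteq> 0}"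
    using assms unfolding is_copy_def S_aleph0_def graph.sel by blast
  have inj: "inj f" and V: "verts F = range f" using f(1) by (auto simp: bij_betw_def)
  have "edges F = {{f 0, f n} | n. n \<noteq> 0}"
    unfolding f(2) by (simp add: setcompr_eq_image image_image)
  also have "\<dots> = {{f 0, y} | y. y \<in> verts F - {f 0}}"
  proof -
    have "f ` {n. n \<noteq> 0} = range f - {f 0}" using inj by (auto simp: inj_eq)
    then have "(\<lambda>y. {f 0, y}) ` (verts F - {f 0}) = (\<lambda>n. {f 0, f n}) ` {n. n \<noteq> 0}"
      unfolding V by (simp flip: image_image[of "\<lambda>y. {f 0, y}" f])
    then show ?thesis by (simp only: setcompr_eq_image Collect_mem_eq)
  qed
  finally have "edges F = {{f 0, y} | y. y \<in> verts F - {f 0}}" .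
  moreover have "infinite (verts F)" unfolding V using inj by (rule range_inj_infinite)
  moreover have "f 0 \<in> verts F" unfolding V by (rule rangeI)
  ultimately show thesis by (intro that)
qed

lemma is_copy_S_aleph0I:
  fixes Y :: "nat set"
  assumes "infinite Y" "c \<notin> Y"
  shows "is_copy S_aleph0 (Graph (insert c Y) {{c, y} | y. y \<in> Y})"
proof -
  define f where "f n = (case n of 0 \<Rightarrow> c | Suc n \<Rightarrow> enumerate Y n)" for n
  have bij: "bij_betw (enumerate Y) UNIV Y" using assms(1) by (rule bij_enumerate)
  have Y: "f ` range Suc = Y" using bij by (simp add: f_def bij_betw_def image_image)
  have "range f = insert (f 0) (f ` range Suc)" by (metis UNIV_nat_eq image_insert)
  also have "\<dots> = insert c Y" unfolding Y by (simp add: f_def)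
  finally have range: "range f = insert c Y" .
  have "inj f"
  proof (rule injI)
    fix i j assume "f i = f j"
    moreover have "enumerate Y n \<in> Y" for n using assms(1) by (rule enumerate_in_set)
    moreover have "inj (enumerate Y)" using bij by (simp add: bij_betw_def)
    ultimately show "i = j"
      using assms(2) by (cases i; cases j) (auto simp: f_def inj_eq)
  qed
  then have "bij_betw f UNIV (insert c Y)" using range by (simp add: bij_betw_def)
  moreover have "{{c, y} | y. y \<in> Y} = (\<lambda>e. f ` e) ` {{0, n} | n. n \<noteq> 0}"
  proof -
    have "range Suc = {n. n \<noteq> 0}" by (auto simp: image_iff gr0_conv_Suc)
    then have "f ` {n. n \<noteq> 0} = Y" using Y by simp
    moreover have "f 0 = c" by (simp add: f_def)
    ultimately have "(\<lambda>y. {c, y}) ` Y = (\<lambda>n. {f 0, f n}) ` {n. n \<noteq> 0}"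
      by (simp flip: image_image[of "\<lambda>y. {c, y}" f])
    then have "{{c, y} | y. y \<in> Y} = {{f 0, f n} | n. n \<noteq> 0}"
      by (simp only: setcompr_eq_image Collect_mem_eq)
    also have "\<dots> = (\<lambda>e. f ` e) ` {{0, n} | n. n \<noteq> 0}"
      by (simp add: setcompr_eq_image image_image)
    finally show ?thesis .
  qed
  ultimately show ?thesis unfolding is_copy_def S_aleph0_def by auto
qed

lemma is_copy_K_aleph0I:
  fixes V :: "nat set"
  assumes "infinite V"
  shows "is_copy K_aleph0 (complete_graph V)"
proof -
  have bij: "bij_betw (enumerate V) UNIV V" using assms by (rule bij_enumerate)
  then have V: "V = range (enumerate V)" and inj: "inj (enumerate V)" by (auto simp: bij_betw_def)
  have edges: "edges (complete_graph W) = (\<lambda>(u, v). {u, v}) ` {(u, v). u \<in> W \<and> v \<in> W \<and> u \<noteq> v}" for W :: "nat set"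
    by (auto simp: complete_graph_def)
  have "{(u, v). u \<in> V \<and> v \<in> V \<and> u \<noteq> v} = map_prod (enumerate V) (enumerate V) ` {(i, j). i \<noteq> j}"
  proof -
    have "{(u, v). u \<in> range (enumerate V) \<and> v \<in> range (enumerate V) \<and> u \<noteq> v} =
        map_prod (enumerate V) (enumerate V) ` {(i, j). i \<noteq> j}"
      using inj by (auto simp: inj_eq)
    then show ?thesis unfolding V[symmetric] .
  qed
  then have "edges (complete_graph V) = (\<lambda>(i, j). {enumerate V i, enumerate V j}) ` {(i, j). i \<noteq> j}"
    unfolding edges by (simp add: image_image case_prod_beta)
  also have "\<dots> = (\<lambda>e. enumerate V ` e) ` edges K_aleph0"
    unfolding edges by (simp add: image_image case_prod_beta)
  finally show ?thesis unfolding is_copy_def using bij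
    by (intro exI[of _ "enumerate V"]) (simp add: complete_graph_def)
qed

section \<open>Maker's win on star patterns\<close>

lemma pattern_family_stars:
  assumes "pattern_family S_aleph0 k C G"
  obtains ctr V where
    "\<And>i j. i \<in> {1..k} \<Longrightarrow> j \<in> {1..C} \<Longrightarrow> infinite (V i j) \<and> ctr i j \<in> V i j \<and> V i j \<subseteq> verts (G i) \<and>
      (\<forall>y\<in>V i j - {ctr i j}. {ctr i j, y} \<in> edges (G i))"
    "\<And>i j i' j'. i \<in> {1..k} \<Longrightarrow> j \<in> {1..C} \<Longrightarrow> i' \<in> {1..k} \<Longrightarrow> j' \<in> {1..C} \<Longrightarrow>
      (i, j) \<noteq> (i', j') \<Longrightarrow> V i j \<inter> V i' j' = {}"
proof -
  have "\<forall>i\<in>{1..k}. \<exists>F. (\<forall>j\<in>{1..C}. is_copy S_aleph0 (F j)) \<and>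
      disjoint_family_on (\<lambda>j. verts (F j)) {1..C} \<and>
      G i = Graph (\<Union>j\<in>{1..C}. verts (F j)) (\<Union>j\<in>{1..C}. edges (F j))"
    using assms unfolding pattern_family_def consists_of_copies_def by blast
  then obtain F where F: "\<And>i j. i \<in> {1..k} \<Longrightarrow> j \<in> {1..C} \<Longrightarrow> is_copy S_aleph0 (F i j)"
    "\<And>i. i \<in> {1..k} \<Longrightarrow> disjoint_family_on (\<lambda>j. verts (F i j)) {1..C}"
    "\<And>i. i \<in> {1..k} \<Longrightarrow> G i = Graph (\<Union>j\<in>{1..C}. verts (F i j)) (\<Union>j\<in>{1..C}. edges (F i j))"
    by metis
  define star where "star H c \<longleftrightarrow> c \<in> verts H \<and> infinite (verts H) \<and>
      edges H = {{c, y} | y. y \<in> verts H - {c}}" for H :: "nat graph" and c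
  define ctr where "ctr i j = (SOME c. star (F i j) c)" for i j
  have ex: "\<exists>c. star (F i j) c" if "i \<in> {1..k}" "j \<in> {1..C}" for i j
    using F(1)[OF that] unfolding star_def by (elim is_copy_S_aleph0D) blast
  have ctr_star: "star (F i j) (ctr i j)" if "i \<in> {1..k}" "j \<in> {1..C}" for i j
    unfolding ctr_def using ex[OF that] by (rule someI_ex)
  note ctr = ctr_star[unfolded star_def]
  have sub: "verts (F i j) \<subseteq> verts (G i)" "edges (F i j) \<subseteq> edges (G i)"
    if "i \<in> {1..k}" "j \<in> {1..C}" for i j
    using that by (auto simp: F(3))
  show thesis
  proof (rule that[of "\<lambda>i j. verts (F i j)" ctr])
    fix i j assume ij: "i \<in> {1..k}" "j \<in> {1..C}"
    have "{ctr i j, y} \<in> edges (F i j)" if "y \<in> verts (F i j) - {ctr i j}" for y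
      using ctr[OF ij] that by blast
    then show "infinite (verts (F i j)) \<and> ctr i j \<in> verts (F i j) \<and> verts (F i j) \<subseteq> verts (G i) \<and>
      (\<forall>y\<in>verts (F i j) - {ctr i j}. {ctr i j, y} \<in> edges (G i))"
      using ctr[OF ij] sub[OF ij] by blast
  next
    fix i j i' j' assume ij: "i \<in> {1..k}" "j \<in> {1..C}" "i' \<in> {1..k}" "j' \<in> {1..C}" "(i, j) \<noteq> (i', j')"
    show "verts (F i j) \<inter> verts (F i' j') = {}"
    proof (cases "i = i'")
      case True
      then show ?thesis using F(2)[OF ij(1)] ij by (auto simp: disjoint_family_on_def)
    next
      case False
      then have "verts (G i) \<inter> verts (G i') = {}"
        using assms ij by (auto simp: pattern_family_def disjoint_family_on_def)
      then show ?thesis using sub[OF ij(1,2)] sub[OF ij(3,4)] by blast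
    qed
  qed
qed

lemma maker_edges_distinct: "play p \<Longrightarrow> {x, y} \<in> maker_edges p \<Longrightarrow> x \<noteq> y"
  unfolding play_def maker_edges_def by (metis edge_K_aleph0_iff imageE range_subsetD)

text \<open>Each pattern graph supplies \<open>m * l\<close> disjoint sets of \<open>a\<close>
  centres, that is, \<open>l\<close> blocks of \<open>m\<close> sets; the \<open>k\<close> pattern
  graphs together give the \<open>n * m\<close> sets for the clique.\<close>

theorem maker_wins_stars:
  fixes k l C a m n :: nat
  defines "n \<equiv> k * l" and "m \<equiv> 2 * (k * l) ^ 3 + 1"
  assumes k: "k \<ge> 1" and l: "l \<ge> 1"
    and a: "a \<ge> (33 * (n * m) ^ 3) ^ (n * m)" and C: "C \<ge> m * l * a"
  shows "maker_has_winning_strategy_par S_aleph0 k C l"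
  unfolding maker_has_winning_strategy_par_def
proof (intro allI impI)
  fix G assume G: "pattern_family S_aleph0 k C G"
  obtain ctr V where V: "\<And>i j. i \<in> {1..k} \<Longrightarrow> j \<in> {1..C} \<Longrightarrow> infinite (V i j) \<and> ctr i j \<in> V i j \<and>
      V i j \<subseteq> verts (G i) \<and> (\<forall>y\<in>V i j - {ctr i j}. {ctr i j, y} \<in> edges (G i))"
    and disj: "\<And>i j i' j'. i \<in> {1..k} \<Longrightarrow> j \<in> {1..C} \<Longrightarrow> i' \<in> {1..k} \<Longrightarrow> j' \<in> {1..C} \<Longrightarrow>
      (i, j) \<noteq> (i', j') \<Longrightarrow> V i j \<inter> V i' j' = {}"
    using pattern_family_stars[OF G] by metis
  have ctr_inj: "i = i' \<and> j = j'" if "ctr i j \<in> V i' j'" "i \<in> {1..k}" "j \<in> {1..C}" "i' \<in> {1..k}" "j' \<in> {1..C}"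
    for i j i' j'
    using disj[of i j i' j'] V[of i j] that by (metis IntI Pair_inject empty_iff)
  have n: "n \<ge> 1" using k l by (simp add: n_def)
  have m: "m > 2 * n ^ 3" by (simp add: m_def n_def)
  have nm: "n * m = k * (m * l)" by (simp add: n_def)
  \<comment> \<open>\<open>q mod (m * l)\<close> selects an interval of \<open>a\<close> star
    indices, half-open on the left because indices run from \<open>1\<close> to \<open>C\<close>;
    \<open>q div (m * l)\<close> selects the pattern graph.\<close>
  define I where "I q = {q mod (m * l) * a <.. Suc (q mod (m * l)) * a}" for q
  define g where "g q = Suc (q div (m * l))" for q
  define As where "As = map (\<lambda>q. ctr (g q) ` I q) [0..<n * m]"
  have ml: "m * l > 0" using m l by simp
  have I: "I q \<subseteq> {1..C}" for q
  proof
    fix x assume x: "x \<in> I q"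
    then have "x \<le> Suc (q mod (m * l)) * a" by (simp add: I_def)
    also have "\<dots> \<le> m * l * a" using ml by (intro mult_right_mono) (simp_all add: Suc_leI)
    finally show "x \<in> {1..C}" using C x by (auto simp: I_def)
  qed
  have g: "g q \<in> {1..k}" if "q < n * m" for q
    using that by (simp add: g_def nm less_mult_imp_div_less Suc_leI)
  have As_mem: "\<exists>i\<in>{1..k}. \<exists>j\<in>{1..C}. s = ctr i j" if "s \<in> \<Union>(set As)" for s
  proof -
    from that obtain q x where q: "q < n * m" "x \<in> I q" "s = ctr (g q) x" by (auto simp: As_def)
    then show ?thesis using g[OF q(1)] I by blast
  qed
  \<comment> \<open>At a centre this union has a single member, since disjoint stars have distinct
    centres.\<close>
  define Lv where "Lv s = \<Union>{V i j - {s} | i j. i \<in> {1..k} \<and> j \<in> {1..C} \<and> s = ctr i j}" for s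
  have Lv: "Lv (ctr i j) = V i j - {ctr i j}" if "i \<in> {1..k}" "j \<in> {1..C}" for i j
  proof -
    have "i' = i \<and> j' = j" if "ctr i j = ctr i' j'" "i' \<in> {1..k}" "j' \<in> {1..C}" for i' j'
      using ctr_inj[of i' j' i j] V[of i j] that \<open>i \<in> {1..k}\<close> \<open>j \<in> {1..C}\<close> by metis
    then show ?thesis using that unfolding Lv_def by blast
  qed
  have "\<exists>\<sigma>. maker_strategy \<sigma> \<and> (\<forall>p. play p \<and> follows \<sigma> p \<longrightarrow>
    (\<exists>X w. length X = n \<and> (\<forall>j<n. \<exists>r<m. X ! j \<in> As ! (j * m + r)) \<and>
      (\<forall>i<n. \<forall>j<n. i \<noteq> j \<longrightarrow> {X ! i, X ! j} \<in> maker_edges p) \<and>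
      (\<forall>d. w d \<in> Lv (X ! (d mod n)) \<and> (\<forall>x\<in>set X. {w d, x} \<in> maker_edges p) \<and>
        (\<forall>e<d. {w d, w e} \<in> maker_edges p))))"
  proof (rule ex_strategy_for_leaves[OF n m])
    show "length As = n * m" by (simp add: As_def)
    show "finite A \<and> (33 * (n * m) ^ 3) ^ (n * m) \<le> card A" if "A \<in> set As" for A
    proof -
      from that obtain q where q: "q < n * m" "A = ctr (g q) ` I q" by (auto simp: As_def)
      have "inj_on (ctr (g q)) (I q)"
      proof (rule inj_onI)
        fix x y assume "x \<in> I q" "y \<in> I q" "ctr (g q) x = ctr (g q) y"
        then show "x = y" using ctr_inj[of "g q" x "g q" y] V[of "g q" y] g[OF q(1)] I by (metis subsetD)
      qed
      then have "card A = a" by (simp add: q card_image I_def)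
      then show ?thesis using a q by (simp add: I_def)
    qed
    show "infinite (Lv s) \<and> Lv s \<inter> \<Union>(set As) = {}" if s: "s \<in> \<Union>(set As)" for s
    proof -
      obtain i j where ij: "i \<in> {1..k}" "j \<in> {1..C}" "s = ctr i j" using As_mem[OF s] by blast
      have "Lv s \<inter> \<Union>(set As) = {}"
      proof (rule ccontr)
        assume "Lv s \<inter> \<Union>(set As) \<noteq> {}"
        then obtain s' where s': "s' \<in> V i j - {ctr i j}" "s' \<in> \<Union>(set As)" using Lv ij by blast
        obtain i' j' where "i' \<in> {1..k}" "j' \<in> {1..C}" "s' = ctr i' j'" using As_mem[OF s'(2)] by blast
        then show False using s'(1) ctr_inj[of i' j' i j] ij by auto
      qed
      then show ?thesis using Lv[OF ij(1,2)] V[OF ij(1,2)] ij(3) by simp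
    qed
  qed
  then obtain \<sigma> where \<sigma>: "maker_strategy \<sigma>" and run: "\<forall>p. play p \<and> follows \<sigma> p \<longrightarrow>
    (\<exists>X w. length X = n \<and> (\<forall>j<n. \<exists>r<m. X ! j \<in> As ! (j * m + r)) \<and>
      (\<forall>i<n. \<forall>j<n. i \<noteq> j \<longrightarrow> {X ! i, X ! j} \<in> maker_edges p) \<and>
      (\<forall>d. w d \<in> Lv (X ! (d mod n)) \<and> (\<forall>x\<in>set X. {w d, x} \<in> maker_edges p) \<and>
        (\<forall>e<d. {w d, w e} \<in> maker_edges p)))"
    by (elim exE conjE) (rule that)
  show "\<exists>\<sigma>. maker_strategy \<sigma> \<and> (\<forall>p. play p \<and> follows \<sigma> p \<longrightarrow> maker_wins_par S_aleph0 k l G p)"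
  proof (intro exI[of _ \<sigma>] conjI \<sigma> allI impI)
    fix p assume p: "play p \<and> follows \<sigma> p"
    from run[THEN spec, THEN mp, OF p] obtain X w where lenX: "length X = n"
      and XA: "\<forall>j<n. \<exists>r<m. X ! j \<in> As ! (j * m + r)"
      and XX: "\<forall>i<n. \<forall>j<n. i \<noteq> j \<longrightarrow> {X ! i, X ! j} \<in> maker_edges p"
      and w: "\<forall>d. w d \<in> Lv (X ! (d mod n)) \<and> (\<forall>x\<in>set X. {w d, x} \<in> maker_edges p) \<and>
        (\<forall>e<d. {w d, w e} \<in> maker_edges p)"
      by (elim exE conjE) (rule that)
    have ne: "x \<noteq> y" if "{x, y} \<in> maker_edges p" for x y
      using maker_edges_distinct p that by blast
    have Xctr: "\<exists>j'\<in>{1..C}. X ! s = ctr (Suc (s div l)) j'" if s: "s < n" for s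
    proof -
      obtain r where r: "r < m" "X ! s \<in> As ! (s * m + r)" using XA s by blast
      have "s * m + r < n * m" using s r(1) by (rule index_bound)
      \<comment> \<open>Each pattern graph owns \<open>l\<close> consecutive blocks, so block
        \<open>s\<close> belongs to the one numbered \<open>Suc (s div l)\<close>.\<close>
      moreover have "g (s * m + r) = Suc (s div l)"
        using r(1) by (simp add: g_def div_mult2_eq)
      ultimately show ?thesis using r(2) I by (auto simp: As_def)
    qed
    have w_inj: "inj w" by (rule linorder_injI) (use w ne in metis)
    define U where "U = set X \<union> range w"
    define K where "K = complete_graph U"
    have infU: "infinite U" using w_inj range_inj_infinite by (auto simp: U_def)
    have KU: "verts K = U" "\<And>x y. {x, y} \<in> edges K \<longleftrightarrow> x \<in> U \<and> y \<in> U \<and> x \<noteq> y"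
      by (auto simp: K_def complete_graph_def doubleton_eq_iff)
    have edgeU: "{x, y} \<in> maker_edges p" if "x \<in> U" "y \<in> U" "x \<noteq> y" for x y
    proof -
      consider "x \<in> set X" "y \<in> set X" | d where "x \<in> set X" "y = w d"
        | d where "x = w d" "y \<in> set X" | d e where "x = w d" "y = w e"
        using \<open>x \<in> U\<close> \<open>y \<in> U\<close> unfolding U_def by blast
      then show ?thesis
      proof cases
        case 1
        then obtain i j where "x = X ! i" "y = X ! j" "i < n" "j < n"
          using lenX by (metis in_set_conv_nth)
        then show ?thesis using XX that(3) by metis
      next
        case 2
        then show ?thesis using w by (simp add: insert_commute)
      next
        case 3
        then show ?thesis using w by simp
      next
        case 4
        then have "d < e \<or> e < d" using that(3) by (metis linorder_neqE_nat)
        moreover have "{w d, w e} = {w e, w d}" by (rule insert_commute)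
        ultimately show ?thesis using w unfolding 4 by metis
      qed
    qed
    have copies: "contains_copies S_aleph0 l (graph_inter (G i) K)" if i: "i \<in> {1..k}" for i
    proof -
      define s where "s t = (i - 1) * l + (t - 1)" for t
      have s: "s t < n \<and> s t div l = i - 1 \<and> s t mod l = t - 1" if "t \<in> {1..l}" for t
      proof -
        obtain x y where xy: "i - 1 = x" "t - 1 = y" by blast
        have "x < k" "y < l" using that i xy by auto
        then show ?thesis unfolding s_def n_def xy using index_bound[of x k y l] by simp
      qed
      \<comment> \<open>The leaves taken for centre \<open>X ! s t\<close> are those of its residue
        class, which makes \<open>Y t\<close> infinite.\<close>
      define Y where "Y t = w ` {d. d mod n = s t}" for t
      define F where "F t = Graph (insert (X ! s t) (Y t)) {{X ! s t, y} | y. y \<in> Y t}" for t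
      have ctr: "\<exists>j\<in>{1..C}. X ! s t = ctr i j" if "t \<in> {1..l}" for t
        using Xctr[of "s t"] s[OF that] i by simp
      have Y_sub: "Y t \<subseteq> V i j - {ctr i j}" if "t \<in> {1..l}" "j \<in> {1..C}" "X ! s t = ctr i j" for t j
      proof
        fix y assume "y \<in> Y t"
        then obtain d where "y = w d" "d mod n = s t" by (auto simp: Y_def)
        then have "y \<in> Lv (X ! s t)" using w by metis
        then show "y \<in> V i j - {ctr i j}" using Lv[OF i that(2)] that(3) by simp
      qed
      have infY: "infinite (Y t)" if "t \<in> {1..l}" for t
      proof -
        have "inj (\<lambda>d. s t + d * n)" using n by (auto simp: inj_def)
        moreover have "range (\<lambda>d. s t + d * n) \<subseteq> {d. d mod n = s t}" using s[OF that] by auto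
        ultimately have "infinite {d. d mod n = s t}" using range_inj_infinite infinite_super by blast
        then show ?thesis unfolding Y_def using w_inj
          by (metis finite_imageD inj_on_subset subset_UNIV)
      qed
      have "is_copy S_aleph0 (F t) \<and> subgraph (F t) (graph_inter (G i) K)" if t: "t \<in> {1..l}" for t
      proof
        obtain j where j: "j \<in> {1..C}" "X ! s t = ctr i j" using ctr[OF t] by blast
        note sub = Y_sub[OF t j]
        have "X ! s t \<notin> Y t" using sub j by auto
        then show "is_copy S_aleph0 (F t)" unfolding F_def by (intro is_copy_S_aleph0I infY t)
        have XU: "X ! s t \<in> U" using s[OF t] lenX by (auto simp: U_def)
        have YU: "Y t \<subseteq> U" by (auto simp: U_def Y_def)
        have "insert (X ! s t) (Y t) \<subseteq> verts (G i)" using V[OF i j(1)] sub j(2) by auto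
        moreover have "{X ! s t, y} \<in> edges (G i)" "{X ! s t, y} \<in> edges K" if "y \<in> Y t" for y
        proof -
          show "{X ! s t, y} \<in> edges (G i)" using V[OF i j(1)] sub j(2) that by auto
          show "{X ! s t, y} \<in> edges K" unfolding KU(2) using XU YU that \<open>X ! s t \<notin> Y t\<close> by auto
        qed
        moreover have "simple_graph (F t)"
          using \<open>X ! s t \<notin> Y t\<close> by (fastforce simp: simple_graph_def F_def complete_graph_def)
        ultimately show "subgraph (F t) (graph_inter (G i) K)"
          using XU YU by (auto simp: subgraph_def graph_inter_def F_def KU(1))
      qed
      moreover have "disjoint_family_on (\<lambda>t. verts (F t)) {1..l}"
        unfolding disjoint_family_on_def
      proof (intro ballI impI)
        fix t t' assume t: "t \<in> {1..l}" "t' \<in> {1..l}" "t \<noteq> t'"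
        obtain j where j: "j \<in> {1..C}" "X ! s t = ctr i j" using ctr[OF t(1)] by blast
        obtain j' where j': "j' \<in> {1..C}" "X ! s t' = ctr i j'" using ctr[OF t(2)] by blast
        have "s t \<noteq> s t'" using s[OF t(1)] s[OF t(2)] t by (metis atLeastAtMost_iff diff_diff_cancel eq_diff_iff)
        then have "X ! s t \<noteq> X ! s t'" using XX s t ne by blast
        then have "j \<noteq> j'" using j j' by auto
        then have "V i j \<inter> V i j' = {}" using disj[OF i j(1) i j'(1)] by simp
        moreover have "verts (F t) \<subseteq> V i j" "verts (F t') \<subseteq> V i j'"
          using Y_sub[OF t(1) j] Y_sub[OF t(2) j'] V[OF i j(1)] V[OF i j'(1)] j j'
          by (auto simp: F_def)
        ultimately show "verts (F t) \<inter> verts (F t') = {}" by blast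
      qed
      ultimately show ?thesis unfolding contains_copies_def by blast
    qed
    show "maker_wins_par S_aleph0 k l G p"
      unfolding maker_wins_par_def
    proof (intro exI[of _ K] conjI ballI copies)
      show "subgraph K K_aleph0"
        by (auto simp: subgraph_def simple_graph_def K_def complete_graph_def)
      show "is_copy K_aleph0 K" unfolding K_def using infU by (rule is_copy_K_aleph0I)
      show "edges K \<subseteq> maker_edges p"
        using edgeU by (auto simp: K_def complete_graph_def)
    qed
  qed
qed

section \<open>Breaker's potential\<close>

text \<open>Against a fixed \<open>\<sigma>\<close>, Breaker's replies are fixed by dependent
  choice; the positions after each round extend one another and define the play.\<close>

lemma ex_play_against:
  assumes \<sigma>: "maker_strategy \<sigma>" and I0: "I []"
    and step: "\<And>h e. position h \<Longrightarrow> even (length h) \<Longrightarrow> I h \<Longrightarrow> e \<in> edges K_aleph0 - set h \<Longrightarrow>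
      \<exists>f\<in>edges K_aleph0 - set (h @ [e]). I (h @ [e, f])"
  shows "\<exists>p. play p \<and> follows \<sigma> p \<and> (\<forall>n. I (map p [0..<2 * n]))"
proof -
  have "\<exists>H. \<forall>n. (position (H n) \<and> length (H n) = 2 * n \<and> I (H n)) \<and>
      (\<exists>f. H (Suc n) = H n @ [\<sigma> (H n), f])"
  proof (rule dependent_nat_choice)
    show "\<exists>h. position h \<and> length h = 2 * 0 \<and> I h" using I0 by (auto simp: position_def)
  next
    fix h n assume h: "position h \<and> length h = 2 * n \<and> I h"
    then have e: "\<sigma> h \<in> edges K_aleph0 - set h" using \<sigma> by (simp add: maker_strategy_def)
    then obtain f where f: "f \<in> edges K_aleph0 - set (h @ [\<sigma> h])" "I (h @ [\<sigma> h, f])"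
      using step[of h "\<sigma> h"] h by auto
    have "position (h @ [\<sigma> h, f])" using h e f(1) by (auto simp: position_def)
    then show "\<exists>y. (position y \<and> length y = 2 * Suc n \<and> I y) \<and> (\<exists>f. y = h @ [\<sigma> h, f])"
      using h f(2) by auto
  qed
  then obtain H where H: "\<And>n. position (H n)" "\<And>n. length (H n) = 2 * n" "\<And>n. I (H n)"
    "\<And>n. \<exists>f. H (Suc n) = H n @ [\<sigma> (H n), f]" by metis
  \<comment> \<open>\<open>H (Suc n)\<close> has \<open>2 * n + 2\<close> entries, so index
    \<open>n\<close> is present, and later positions agree there.\<close>
  define p where "p n = H (Suc n) ! n" for n
  have pre: "prefix (H n) (H (n + d))" for n d
  proof (induction d)
    case (Suc d)
    then show ?case using H(4)[of "n + d"] by (auto simp: prefix_def)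
  qed simp
  have nth: "H n ! i = p i" if "i < 2 * n" for n i
  proof -
    have eq: "xs ! i = ys ! i" if "prefix xs ys" "i < length xs" for xs ys :: "nat set list"
      using that by (auto simp: prefix_def nth_append)
    show ?thesis
    proof (cases "n \<le> Suc i")
      case True
      then show ?thesis using eq[OF pre[of n "Suc i - n"]] that H(2)[of n] by (simp add: p_def)
    next
      case False
      then show ?thesis using eq[OF pre[of "Suc i" "n - Suc i"]] that H(2)[of "Suc i"] by (simp add: p_def)
    qed
  qed
  have map: "map p [0..<2 * n] = H n" for n
    by (rule nth_equalityI) (simp_all add: H(2) nth)
  have "play p"
    unfolding play_def
  proof
    show "inj p"
    proof (rule linorder_injI)
      fix x y :: nat assume "x < y"
      moreover have "distinct (H (Suc y))" using H(1) by (simp add: position_def)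
      ultimately have "H (Suc y) ! x \<noteq> H (Suc y) ! y"
        using H(2)[of "Suc y"] nth_eq_iff_index_eq[of "H (Suc y)" x y] by simp
      then show "p x \<noteq> p y" using \<open>x < y\<close> nth[of x "Suc y"] nth[of y "Suc y"] by simp
    qed
    have "p x \<in> set (H (Suc x))" for x unfolding p_def using H(2)[of "Suc x"] by (intro nth_mem) simp
    then show "range p \<subseteq> edges K_aleph0" using H(1) by (auto simp: position_def)
  qed
  moreover have "follows \<sigma> p"
    unfolding follows_def
  proof (intro allI impI)
    fix n :: nat assume "even n"
    then obtain i where n: "n = 2 * i" by (elim evenE)
    have "p n = H (Suc i) ! n" using nth[of n "Suc i"] n by simp
    also have "\<dots> = \<sigma> (H i)" using H(4)[of i] H(2)[of i] n by (auto simp: nth_append)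
    finally show "p n = \<sigma> (map p [0..<n])" by (simp only: n map)
  qed
  ultimately show ?thesis using H(3) map by metis
qed

text \<open>The Erdos-Selfridge potential once Maker has claimed \<open>M\<close> and Breaker has claimed \<open>B\<close>.\<close>

definition danger :: "'a set set \<Rightarrow> 'a set \<Rightarrow> 'a set \<Rightarrow> real" where
  "danger W M B = (\<Sum>A\<in>W. if A \<inter> B = {} then (1 / 2) ^ card (A - M) else 0)"

text \<open>Breaker takes the edge of greatest weight. This removes \<open>g f\<close> from the
  potential, while Maker's next edge doubles only sets containing it and so adds at most
  \<open>g e \<le> g f\<close>.\<close>

lemma danger_reply:
  assumes fin: "finite W" "\<And>A. A \<in> W \<Longrightarrow> finite A" and X: "X \<noteq> {}" "X \<inter> M = {}"
  shows "\<exists>f\<in>X. \<forall>e\<in>X - {f}. danger W (insert e M) (insert f B) \<le> danger W M B"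
proof -
  define t where "t A = (if A \<inter> B = {} then (1 / 2) ^ card (A - M) else (0::real))" for A
  define g where "g f = (\<Sum>A\<in>W. if f \<in> A then t A else 0)" for f
  \<comment> \<open>\<open>X\<close> may be infinite, but the weight depends only on which members
    of \<open>W\<close> contain the edge, so a maximum exists.\<close>
  have "g ` X \<subseteq> (\<lambda>V. \<Sum>A\<in>W. if A \<in> V then t A else 0) ` Pow W"
  proof
    fix y assume "y \<in> g ` X"
    then obtain f where "y = g f" by blast
    then have "y = (\<Sum>A\<in>W. if A \<in> {A\<in>W. f \<in> A} then t A else 0)"
      unfolding g_def by (auto intro!: sum.cong)
    then show "y \<in> (\<lambda>V. \<Sum>A\<in>W. if A \<in> V then t A else 0) ` Pow W" by blast
  qed
  then have "finite (g ` X)" by (rule finite_subset) (use fin(1) in simp)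
  then have "Max (g ` X) \<in> g ` X" and Max: "\<And>e. e \<in> X \<Longrightarrow> g e \<le> Max (g ` X)"
    using X by (auto intro: Max_in)
  then obtain f where "f \<in> X" "Max (g ` X) = g f" by blast
  with Max have f: "f \<in> X" "\<And>e. e \<in> X \<Longrightarrow> g e \<le> g f" by simp_all
  have "danger W (insert e M) (insert f B) \<le> danger W M B" if e: "e \<in> X - {f}" for e
  proof -
    have "danger W (insert e M) (insert f B) \<le>
        (\<Sum>A\<in>W. t A - (if f \<in> A then t A else 0) + (if e \<in> A then t A else 0))"
      unfolding danger_def
    proof (rule sum_mono)
      fix A assume A: "A \<in> W"
      have t0: "t A \<ge> 0" by (simp add: t_def)
      show "(if A \<inter> insert f B = {} then (1 / 2) ^ card (A - insert e M) else 0) \<le>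
        t A - (if f \<in> A then t A else 0) + (if e \<in> A then t A else 0)"
      proof (cases "A \<inter> insert f B = {}")
        case True
        then have "f \<notin> A" "t A = (1 / 2) ^ card (A - M)" by (auto simp: t_def)
        moreover have "(1 / 2 :: real) ^ card (A - insert e M) = 2 * (1 / 2) ^ card (A - M)" if "e \<in> A"
        proof -
          have "e \<in> A - M" using that e X(2) by auto
          moreover have "A - insert e M = A - M - {e}" by auto
          ultimately have "card (A - M) = Suc (card (A - insert e M))"
            using fin(2)[OF A] by (metis card_Suc_Diff1 finite_Diff)
          then show ?thesis by simp
        qed
        moreover have "A - insert e M = A - M" if "e \<notin> A" using that by auto
        ultimately show ?thesis using True by auto
      qed (use t0 in auto)
    qed
    also have "\<dots> = danger W M B - g f + g e"
      by (simp add: sum.distrib sum_subtractf g_def danger_def t_def)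
    also have "\<dots> \<le> danger W M B" using f(2)[of e] e by simp
    finally show ?thesis .
  qed
  with f(1) show ?thesis by blast
qed

text \<open>Maker moves first and may double the potential before Breaker answers, hence
  \<open>1 / 2\<close> instead of \<open>1\<close>. A set completed by Maker would contribute
  \<open>1\<close> on its own.\<close>

theorem Erdos_Selfridge:
  assumes \<sigma>: "maker_strategy \<sigma>" and fin: "finite W" "\<And>A. A \<in> W \<Longrightarrow> finite A"
    and small: "(\<Sum>A\<in>W. (1 / 2) ^ card A) < (1 / 2 :: real)"
  shows "\<exists>p. play p \<and> follows \<sigma> p \<and> (\<forall>A\<in>W. \<not> A \<subseteq> maker_edges p)"
proof -
  define bk where "bk h = set h - maker_claimed h" for h :: "nat set list"
  \<comment> \<open>The invariant looks one move ahead, at every edge that Maker may claim next;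
    this is the form preserved by \<open>danger_reply\<close>.\<close>
  define I where "I h \<longleftrightarrow> (\<forall>e\<in>edges K_aleph0 - set h. danger W (insert e (maker_claimed h)) (bk h) < 1)" for h
  have "\<exists>p. play p \<and> follows \<sigma> p \<and> (\<forall>n. I (map p [0..<2 * n]))"
  proof (rule ex_play_against[OF \<sigma>])
    have "danger W {e} {} < 1" for e
    proof -
      have "danger W {e} {} \<le> (\<Sum>A\<in>W. 2 * (1 / 2) ^ card A)"
        unfolding danger_def
      proof (rule sum_mono)
        fix A assume "A \<in> W"
        have "card A \<le> Suc (card (A - {e}))"
          using diff_card_le_card_Diff[of "{e}" A] by simp
        then have "(1 / 2 :: real) ^ Suc (card (A - {e})) \<le> (1 / 2) ^ card A"
          by (intro power_decreasing) auto
        then show "(if A \<inter> {} = {} then (1 / 2) ^ card (A - {e}) else 0) \<le> 2 * (1 / 2 :: real) ^ card A"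
          by simp
      qed
      also have "\<dots> < 1" using small by (simp flip: sum_distrib_left)
      finally show ?thesis .
    qed
    then show "I []" by (simp add: I_def bk_def maker_claimed_def)
  next
    fix h e assume h: "position h" "even (length h)" "I h" and e: "e \<in> edges K_aleph0 - set h"
    let ?X = "edges K_aleph0 - set (h @ [e])"
    let ?M = "insert e (maker_claimed h)"
    have "?X \<noteq> {}" using ex_unclaimed_edge[of "h @ [e]"] by blast
    moreover have "?X \<inter> ?M = {}" using maker_claimed_subset_set[of h] by auto
    ultimately obtain f where f: "f \<in> ?X"
      "\<And>e'. e' \<in> ?X - {f} \<Longrightarrow> danger W (insert e' ?M) (insert f (bk h)) \<le> danger W ?M (bk h)"
      using danger_reply[OF fin, of ?X ?M "bk h"] by blast
    have maker_claimed: "maker_claimed (h @ [e, f]) = ?M" using h(2) by (rule maker_claimed_append_two)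
    have bk: "bk (h @ [e, f]) = insert f (bk h)"
      using f(1) e maker_claimed_subset_set[of h] by (auto simp: bk_def maker_claimed)
    have "I (h @ [e, f])"
      unfolding I_def maker_claimed bk
    proof
      fix e' assume "e' \<in> edges K_aleph0 - set (h @ [e, f])"
      then have "danger W (insert e' ?M) (insert f (bk h)) \<le> danger W ?M (bk h)" by (intro f(2)) auto
      also have "\<dots> < 1" using h(3) e by (simp add: I_def)
      finally show "danger W (insert e' ?M) (insert f (bk h)) < 1" .
    qed
    with f(1) show "\<exists>f\<in>?X. I (h @ [e, f])" by blast
  qed
  then obtain p where p: "play p" "follows \<sigma> p" "\<And>n. I (map p [0..<2 * n])" by blast
  have "\<not> A \<subseteq> maker_edges p" if A: "A \<in> W" for A
  proof
    assume "A \<subseteq> maker_edges p"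
    then have "\<exists>J. finite J \<and> J \<subseteq> {n. even n} \<and> A = p ` J"
      unfolding maker_edges_def using finite_subset_image[OF fin(2)[OF A]] by metis
    then obtain J where J: "finite J" "J \<subseteq> {n. even n}" "A = p ` J" by blast
    \<comment> \<open>A finite set is completed within finitely many moves, so some position already
      contains all of it.\<close>
    define n where "n = Suc (Max (insert 0 J))"
    let ?h = "map p [0..<2 * n]"
    have "i < n" if "i \<in> J" for i
      using J(1) that by (auto simp: n_def less_Suc_eq_le intro: Max_ge)
    then have "A \<subseteq> maker_claimed ?h"
      using J by (fastforce simp: maker_claimed_def)
    then have disj: "A \<inter> bk ?h = {}" and sub: "A \<subseteq> insert e (maker_claimed ?h)" for e by (auto simp: bk_def)
    obtain e where e: "e \<in> edges K_aleph0 - set ?h" using ex_unclaimed_edge by blast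
    have "A - insert e (maker_claimed ?h) = {}" using sub by blast
    then have card_0: "card (A - insert e (maker_claimed ?h)) = 0" by (simp only: card.empty)
    have "1 = (if A \<inter> bk ?h = {} then (1 / 2 :: real) ^ card (A - insert e (maker_claimed ?h)) else 0)"
      unfolding disj card_0 by simp
    also have "\<dots> \<le> danger W (insert e (maker_claimed ?h)) (bk ?h)"
      unfolding danger_def
      by (rule member_le_sum[where f = "\<lambda>A. if A \<inter> bk ?h = {} then (1 / 2 :: real) ^ card (A - insert e (maker_claimed ?h)) else 0"])
        (use A fin in auto)
    also have "\<dots> < 1" using p(3)[of n] e by (simp only: I_def)
    finally show False by simp
  qed
  with p show ?thesis by blast
qed

lemma card_edges_complete_graph:
  assumes "finite S"
  shows "card (edges (complete_graph S)) = card S choose 2" "finite (edges (complete_graph S))"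
proof -
  have "edges (complete_graph S) = {A. A \<subseteq> S \<and> card A = 2}"
    by (auto simp: complete_graph_def card_2_iff)
  then show "card (edges (complete_graph S)) = card S choose 2" "finite (edges (complete_graph S))"
    using assms by (simp_all add: n_subsets)
qed

lemma is_copy_complete_graphD:
  assumes "is_copy (complete_graph U) K" "x \<in> verts K" "y \<in> verts K" "x \<noteq> y"
  shows "{x, y} \<in> edges K"
proof -
  obtain f where f: "bij_betw f U (verts K)"
    "edges K = (\<lambda>e. f ` e) ` edges (complete_graph U)"
    using assms(1) by (auto simp: is_copy_def complete_graph_def)
  obtain u v where uv: "x = f u" "y = f v" "u \<in> U" "v \<in> U"
    using f(1) assms(2,3) unfolding bij_betw_def by blast
  with assms(4) have "{u, v} \<in> edges (complete_graph U)" by (auto simp: complete_graph_def)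
  then have "f ` {u, v} \<in> edges K" unfolding f(2) by (rule imageI)
  then show ?thesis using uv by simp
qed

section \<open>Disjoint stars on the natural numbers\<close>

definition star_vertex :: "nat \<Rightarrow> nat \<Rightarrow> nat \<Rightarrow> nat" where
  "star_vertex i c r = prod_encode (prod_encode (i, c), r)"

lemma star_vertex_eq_iff: "star_vertex i c r = star_vertex i' c' r' \<longleftrightarrow> i = i' \<and> c = c' \<and> r = r'"
  by (simp add: star_vertex_def)

definition star_graph :: "nat \<Rightarrow> nat \<Rightarrow> nat graph" where
  "star_graph i c = Graph (range (star_vertex i c)) {{star_vertex i c 0, star_vertex i c r} | r. r \<noteq> 0}"

definition star_union :: "nat \<Rightarrow> nat \<Rightarrow> nat graph" where
  "star_union C i = Graph (\<Union>c\<in>{1..C}. verts (star_graph i c)) (\<Union>c\<in>{1..C}. edges (star_graph i c))"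

lemma pattern_family_star_union: "pattern_family S_aleph0 k C (star_union C)"
proof -
  have copy: "is_copy S_aleph0 (star_graph i c)" for i c
    unfolding is_copy_def
  proof (intro exI[of _ "star_vertex i c"] conjI)
    show "bij_betw (star_vertex i c) (verts S_aleph0) (verts (star_graph i c))"
      by (auto simp: S_aleph0_def star_graph_def bij_betw_def inj_def star_vertex_eq_iff)
    show "edges (star_graph i c) = (\<lambda>e. star_vertex i c ` e) ` edges S_aleph0"
      by (simp add: S_aleph0_def star_graph_def setcompr_eq_image image_image)
  qed
  have "consists_of_copies S_aleph0 C (star_union C i)" for i
    unfolding consists_of_copies_def
  proof (intro exI[of _ "star_graph i"] conjI ballI copy)
    show "disjoint_family_on (\<lambda>j. verts (star_graph i j)) {1..C}"
      by (auto simp: disjoint_family_on_def star_graph_def star_vertex_eq_iff)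
  qed (simp add: star_union_def)
  moreover have "subgraph (star_union C i) K_aleph0" for i
    unfolding subgraph_def simple_graph_def star_union_def star_graph_def complete_graph_def
    by (fastforce simp: star_vertex_eq_iff)
  moreover have "disjoint_family_on (\<lambda>i. verts (star_union C i)) {1..k}"
    by (auto simp: disjoint_family_on_def star_union_def star_graph_def star_vertex_eq_iff)
  ultimately show ?thesis by (simp add: pattern_family_def)
qed

text \<open>One edge of \<open>F\<close> suffices: it lies in some \<open>star_graph\<close> and
  hence contains the centre of that star.\<close>

lemma star_in_star_union:
  assumes copy: "is_copy S_aleph0 F" and sub: "edges F \<subseteq> edges (star_union C i)"
  shows "\<exists>c\<in>{1..C}. star_vertex i c 0 \<in> verts F"
proof -
  obtain z where z: "z \<in> verts F" "infinite (verts F)" "edges F = {{z, y} | y. y \<in> verts F - {z}}"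
    using copy by (rule is_copy_S_aleph0D)
  obtain y where y: "y \<in> verts F - {z}"
    using z(2) by (metis finite.emptyI finite_Diff_insert finite_Diff2 ex_in_conv finite_insert infinite_remove)
  have E: "\<exists>c\<in>{1..C}. \<exists>r. r \<noteq> 0 \<and> {z, y} = {star_vertex i c 0, star_vertex i c r}" if "y \<in> verts F - {z}" for y
  proof -
    have "{z, y} \<in> edges (star_union C i)" using z(3) that sub by blast
    then show ?thesis by (auto simp: star_union_def star_graph_def)
  qed
  from E[OF y] obtain c r where c: "c \<in> {1..C}" "{z, y} = {star_vertex i c 0, star_vertex i c r}" by blast
  then have "star_vertex i c 0 = z \<or> star_vertex i c 0 = y" by (metis doubleton_eq_iff)
  then show ?thesis using c(1) y z(1) by auto
qed

text \<open>A clique that wins for Maker contains a centre for each of the \<open>k * l\<close>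
  copies, so it includes one of at most \<open>C ^ (k * l)\<close> cliques of centres;
  \<open>small\<close> is the Erdos-Selfridge condition for these.\<close>

theorem breaker_wins_stars:
  assumes small: "2 * C ^ (k * l) < (2::nat) ^ (k * l choose 2)"
  shows "\<not> maker_has_winning_strategy_par S_aleph0 k C l"
proof
  assume "maker_has_winning_strategy_par S_aleph0 k C l"
  then obtain \<sigma> where \<sigma>: "maker_strategy \<sigma>"
    "\<And>p. play p \<Longrightarrow> follows \<sigma> p \<Longrightarrow> maker_wins_par S_aleph0 k l (star_union C) p"
    using pattern_family_star_union[of k C] unfolding maker_has_winning_strategy_par_def by blast
  define T where "T = {1..k} \<times> {1..l}"
  define x where "x f = (\<lambda>(i, j). star_vertex i (f (i, j)) 0)" for f :: "nat \<times> nat \<Rightarrow> nat"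
  \<comment> \<open>Restricting to injective choices gives every member exactly
    \<open>k * l choose 2\<close> edges.\<close>
  define W where "W = (\<lambda>f. edges (complete_graph (x f ` T))) ` {f \<in> PiE T (\<lambda>_. {1..C}). inj_on (x f) T}"
  have finT: "finite T" by (simp add: T_def)
  then have finP: "finite (PiE T (\<lambda>_. {1..C}))" by (intro finite_PiE) auto
  have cardP: "card (PiE T (\<lambda>_. {1..C})) = C ^ (k * l)"
    using finT by (simp add: card_PiE T_def)
  have cardA: "card A = k * l choose 2" "finite A" if "A \<in> W" for A
  proof -
    from that obtain f where "A = edges (complete_graph (x f ` T))" "inj_on (x f) T" by (auto simp: W_def)
    then show "card A = k * l choose 2" "finite A"
      using finT by (simp_all add: card_edges_complete_graph card_image T_def)
  qed
  have finW: "finite W" using finP by (simp add: W_def)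
  have "card W \<le> card {f \<in> PiE T (\<lambda>_. {1..C}). inj_on (x f) T}"
    unfolding W_def using finP by (intro card_image_le) auto
  also have "\<dots> \<le> C ^ (k * l)"
    unfolding cardP[symmetric] using finP by (intro card_mono) auto
  finally have cardW: "card W \<le> C ^ (k * l)" .
  have "(\<Sum>A\<in>W. (1 / 2 :: real) ^ card A) = real (card W) / 2 ^ (k * l choose 2)"
    using cardA by (simp add: power_one_over)
  also have "\<dots> < 1 / 2"
  proof -
    have "real (2 * card W) < real (2 ^ (k * l choose 2))"
      using cardW small by (intro of_nat_less_iff[THEN iffD2]) linarith
    then show ?thesis by (simp add: field_simps)
  qed
  finally obtain p where p: "play p" "follows \<sigma> p" "\<And>A. A \<in> W \<Longrightarrow> \<not> A \<subseteq> maker_edges p"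
    using Erdos_Selfridge[OF \<sigma>(1) finW cardA(2)] by blast
  from \<sigma>(2)[OF p(1,2)] obtain K where K: "is_copy K_aleph0 K" "edges K \<subseteq> maker_edges p"
    "\<And>i. i \<in> {1..k} \<Longrightarrow> contains_copies S_aleph0 l (graph_inter (star_union C i) K)"
    unfolding maker_wins_par_def by blast
  have "\<forall>i\<in>{1..k}. \<exists>F. (\<forall>j\<in>{1..l}. is_copy S_aleph0 (F j) \<and> subgraph (F j) (graph_inter (star_union C i) K)) \<and>
      disjoint_family_on (\<lambda>j. verts (F j)) {1..l}"
    using K(3) unfolding contains_copies_def by blast
  then obtain F where F: "\<And>i j. i \<in> {1..k} \<Longrightarrow> j \<in> {1..l} \<Longrightarrow> is_copy S_aleph0 (F i j)"
    "\<And>i j. i \<in> {1..k} \<Longrightarrow> j \<in> {1..l} \<Longrightarrow> subgraph (F i j) (graph_inter (star_union C i) K)"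
    "\<And>i. i \<in> {1..k} \<Longrightarrow> disjoint_family_on (\<lambda>j. verts (F i j)) {1..l}"
    by metis
  have "\<exists>c\<in>{1..C}. star_vertex i c 0 \<in> verts (F i j)" if "i \<in> {1..k}" "j \<in> {1..l}" for i j
    using F(1)[OF that] F(2)[OF that] by (intro star_in_star_union) (auto simp: subgraph_def graph_inter_def)
  then have "\<exists>c. \<forall>i\<in>{1..k}. \<forall>j\<in>{1..l}. c i j \<in> {1..C} \<and> star_vertex i (c i j) 0 \<in> verts (F i j)"
    by metis
  then obtain c where c: "\<And>i j. i \<in> {1..k} \<Longrightarrow> j \<in> {1..l} \<Longrightarrow> c i j \<in> {1..C}"
    "\<And>i j. i \<in> {1..k} \<Longrightarrow> j \<in> {1..l} \<Longrightarrow> star_vertex i (c i j) 0 \<in> verts (F i j)" by metis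
  define f where "f = restrict (\<lambda>(i, j). c i j) T"
  have xf: "x f (i, j) = star_vertex i (c i j) 0" if "(i, j) \<in> T" for i j
    using that by (simp add: x_def f_def)
  \<comment> \<open>Copies within one pattern graph are disjoint, and centres of different pattern
    graphs are encoded differently.\<close>
  have "inj_on (x f) T"
  proof (rule inj_onI)
    fix s t assume st: "s \<in> T" "t \<in> T" "x f s = x f t"
    obtain i j i' j' where ij: "s = (i, j)" "t = (i', j')" by (metis surj_pair)
    have eq: "i = i'" using st ij xf by (simp add: star_vertex_eq_iff)
    have mem: "i \<in> {1..k}" "j \<in> {1..l}" "j' \<in> {1..l}" using st ij by (auto simp: T_def)
    have "star_vertex i (c i j) 0 \<in> verts (F i j) \<inter> verts (F i j')"
      using c(2)[OF mem(1,2)] c(2)[OF mem(1,3)] st ij xf eq by simp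
    then have "j = j'" using F(3)[OF mem(1)] mem unfolding disjoint_family_on_def by blast
    with eq ij show "s = t" by simp
  qed
  moreover have "f \<in> PiE T (\<lambda>_. {1..C})" using c(1) by (auto simp: f_def T_def)
  ultimately have "edges (complete_graph (x f ` T)) \<in> W" by (auto simp: W_def)
  moreover have "edges (complete_graph (x f ` T)) \<subseteq> edges K"
  proof -
    have "x f ` T \<subseteq> verts K"
    proof
      fix y assume "y \<in> x f ` T"
      then obtain i j where ij: "(i, j) \<in> T" "y = x f (i, j)" by auto
      then have mem: "i \<in> {1..k}" "j \<in> {1..l}" by (auto simp: T_def)
      have "verts (F i j) \<subseteq> verts K" using F(2)[OF mem] by (auto simp: subgraph_def graph_inter_def)
      then show "y \<in> verts K" using c(2)[OF mem] xf[OF ij(1)] ij(2) by auto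
    qed
    then show ?thesis
      using is_copy_complete_graphD[OF K(1)] unfolding complete_graph_def graph.sel by blast
  qed
  ultimately show False using p(3) K(2) by blast
qed

section \<open>Bounds\<close>

lemma real_choose_two: "real (n choose 2) = real n * (real n - 1) / 2"
proof -
  have "even (n * (n - 1))" by (cases n) simp_all
  then have "real (n choose 2) = real (n * (n - 1)) / 2"
    by (simp only: choose_two real_of_nat_div)
  then show ?thesis by (cases n) (simp_all add: algebra_simps)
qed

text \<open>With \<open>2 powr ((n - 3) / 2)\<close> in place of \<open>C\<close>, the two sides of
  Breaker's condition have exponents \<open>1 + n * (n - 3) / 2\<close> and
  \<open>n * (n - 1) / 2\<close>, which differ by \<open>n - 1\<close>.\<close>

lemma f_par_lower:
  assumes "k * l = n" "n \<ge> 1"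
  shows "ereal (2 powr ((real n - 3) / 2)) < ereal_of_enat (f_par S_aleph0 k l)"
proof (cases "\<exists>a. maker_has_winning_strategy_par S_aleph0 k a l")
  case True
  define C where "C = (LEAST a. maker_has_winning_strategy_par S_aleph0 k a l)"
  have "maker_has_winning_strategy_par S_aleph0 k C l"
    unfolding C_def using True by (rule LeastI_ex)
  then have C: "\<not> 2 * C ^ n < (2::nat) ^ (n choose 2)"
    using breaker_wins_stars assms(1) by blast
  have "2 powr ((real n - 3) / 2) < real C"
  proof (rule ccontr)
    assume "\<not> ?thesis"
    then have le: "real C \<le> 2 powr ((real n - 3) / 2)" by simp
    have "real (2 * C ^ n) < real (2 ^ (n choose 2))"
    \<comment> \<open>For \<open>n = 1\<close> the exponents coincide, but then \<open>C\<close> is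
      a natural number below \<open>1\<close>.\<close>
    proof (cases "n = 1")
      case True
      have "2 powr ((real n - 3) / 2) < 1" using True by (simp add: powr_minus_divide)
      with le have "C = 0" by linarith
      then show ?thesis using True by simp
    next
      case False
      have "real (2 * C ^ n) \<le> 2 * (2 powr ((real n - 3) / 2)) ^ n"
        using le by (simp add: power_mono)
      also have "\<dots> = 2 powr (1 + (real n - 3) / 2 * real n)"
        by (simp add: powr_add powr_powr flip: powr_realpow)
      also have "\<dots> < 2 powr (real (n choose 2))"
        using False assms(2) by (intro powr_less_mono) (simp_all add: real_choose_two field_simps)
      also have "\<dots> = real (2 ^ (n choose 2))" by (simp add: powr_realpow)
      finally show ?thesis .
    qed
    with C show False by (simp only: of_nat_less_iff)
  qed
  moreover have "f_par S_aleph0 k l = enat C" using True by (simp add: f_par_def C_def)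
  ultimately show ?thesis by simp
qed (simp add: f_par_def)

lemma le_two_power_self: "(n::nat) \<le> 2 ^ n"
  using less_exp[of n] by simp

lemma f_par_upper:
  assumes kl: "k * l = n" "k \<ge> 1" "l \<ge> 1"
  shows "f_par S_aleph0 k l \<le> enat (2 ^ (90 * n ^ 8))"
proof -
  define m where "m = 2 * n ^ 3 + 1"
  define N where "N = n * m"
  define a where "a = (33 * N ^ 3) ^ N"
  have n: "n \<ge> 1" using kl by (metis One_nat_def Suc_leI mult_is_0 not_less_eq_eq zero_less_iff_neq_zero)
  have "maker_has_winning_strategy_par S_aleph0 k (m * l * a) l"
    unfolding m_def kl(1)[symmetric]
    by (rule maker_wins_stars[OF kl(2,3), of a])
      (simp_all add: a_def N_def m_def kl(1))
  then have "f_par S_aleph0 k l \<le> enat (m * l * a)"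
    by (auto simp: f_par_def intro: Least_le)
  also have "m * l * a \<le> 2 ^ (90 * n ^ 8)"
  proof -
    have N1: "N \<ge> 1" using n by (simp add: N_def m_def)
    have "l \<le> n" using kl by (metis mult.commute mult_le_mono1 nat_mult_1_right mult_1 order_refl mult_le_mono)
    then have "m * l \<le> N" by (simp add: N_def)
    also have "\<dots> \<le> 2 ^ N" by (rule le_two_power_self)
    finally have 1: "m * l \<le> 2 ^ N" .
    have "33 * N ^ 3 \<le> 2 ^ 6 * (2 ^ N) ^ 3"
      using le_two_power_self[of N] by (intro mult_mono power_mono) auto
    also have "\<dots> = 2 ^ (6 + N * 3)" unfolding power_add power_mult ..
    finally have "a \<le> (2 ^ (6 + N * 3)) ^ N" unfolding a_def by (rule power_mono) simp
    then have 2: "a \<le> 2 ^ ((6 + N * 3) * N)" by (simp only: power_mult)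
    have "m * l * a \<le> 2 ^ N * 2 ^ ((6 + N * 3) * N)"
      using 1 2 by (rule mult_mono) auto
    also have "\<dots> = 2 ^ (N + (6 + N * 3) * N)" by (simp only: power_add)
    also have "\<dots> \<le> 2 ^ (90 * n ^ 8)"
    proof (rule power_increasing)
      \<comment> \<open>The exponent is \<open>3 * N ^ 2 + 7 * N \<le> 10 * N ^ 2\<close>, and
        \<open>N \<le> 3 * n ^ 4\<close> turns this into \<open>90 * n ^ 8\<close>.\<close>
      have "N * 1 \<le> N * N" using N1 by (rule mult_left_mono) simp
      then have "N + (6 + N * 3) * N \<le> 10 * (N * N)" by (simp add: algebra_simps)
      also have "N \<le> 3 * n ^ 4"
      proof -
        have "m \<le> 3 * n ^ 3" using n by (simp add: m_def)
        then have "n * m \<le> n * (3 * n ^ 3)" by (rule mult_left_mono) simp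
        then show ?thesis by (simp add: N_def power_eq_if)
      qed
      then have "10 * (N * N) \<le> 10 * ((3 * n ^ 4) * (3 * n ^ 4))" by (intro mult_mono) auto
      also have "\<dots> = 90 * n ^ 8" by (simp flip: power_add)
      finally show "N + (6 + N * 3) * N \<le> 90 * n ^ 8" .
    qed simp
    finally show ?thesis .
  qed
  finally show ?thesis by simp
qed

section \<open>Error terms as functions of the product \<open>k * l\<close>\<close>

lemma tendsto_filtercomap_mult:
  assumes "g \<longlonglongrightarrow> c"
  shows "((\<lambda>(k, l). g (k * l)) \<longlongrightarrow> c) (filtercomap (\<lambda>(k, l). k * l) at_top)"
proof -
  have "((\<lambda>x. g ((\<lambda>(k, l). k * l) x)) \<longlongrightarrow> c) (filtercomap (\<lambda>(k, l). k * l) at_top)"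
    by (rule filterlim_compose[OF assms filterlim_filtercomap])
  moreover have "(\<lambda>(k, l). g (k * l)) = (\<lambda>x. g ((\<lambda>(k, l). k * l) x))" by auto
  ultimately show ?thesis by (simp only:)
qed

theorem theorem1p3:
  "\<exists>\<epsilon> \<delta> :: nat \<Rightarrow> nat \<Rightarrow> real.
     ((\<lambda>(k, l). \<epsilon> k l) \<longlongrightarrow> 0) (filtercomap (\<lambda>(k, l). k * l) at_top) \<and>
     ((\<lambda>(k, l). \<delta> k l) \<longlongrightarrow> 0) (filtercomap (\<lambda>(k, l). k * l) at_top) \<and>
     (\<forall>k\<ge>1. \<forall>l\<ge>1.
        ereal (2 powr ((1 - \<epsilon> k l) * (real k * real l / 2)))
          < ereal_of_enat (f_par S_aleph0 k l) \<and>
        ereal_of_enat (f_par S_aleph0 k l)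
          \<le> ereal (2 powr (2 powr ((1 + \<delta> k l) * (real k * real l)))))"
proof -
  \<comment> \<open>Chosen so that \<open>(1 - e n) * (n / 2) = (n - 3) / 2\<close>.\<close>
  define e where "e n = 3 / real n" for n :: nat
  \<comment> \<open>Chosen so that \<open>2 powr ((1 + d n) * n)\<close> equals
    \<open>2 ^ n * 90 * n ^ 8\<close> for \<open>n \<ge> 1\<close>; the factor \<open>2 ^ n\<close>
    is then bounded below by \<open>1\<close>.\<close>
  define d where "d n = log 2 90 / real n + 8 / ln 2 * (ln (real n) / real n)" for n :: nat
  have "e \<longlonglongrightarrow> 0" unfolding e_def by (rule lim_const_over_n)
  moreover have "d \<longlonglongrightarrow> 0"
  proof -
    have "d \<longlonglongrightarrow> 0 + 8 / ln 2 * 0"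
      unfolding d_def
      by (intro tendsto_intros lim_const_over_n
        filterlim_compose[OF ln_x_over_x_tendsto_0 filterlim_real_sequentially])
    then show ?thesis by simp
  qed
  moreover have "ereal (2 powr ((1 - e (k * l)) * (real k * real l / 2))) < ereal_of_enat (f_par S_aleph0 k l)"
    (is ?lower)
    and "ereal_of_enat (f_par S_aleph0 k l) \<le> ereal (2 powr (2 powr ((1 + d (k * l)) * (real k * real l))))"
    (is ?upper) if kl: "k \<ge> 1" "l \<ge> 1" for k l
  proof -
    define n where "n = k * l"
    have n: "n \<ge> 1" using mult_le_mono[OF kl] by (simp add: n_def)
    have real_n: "real k * real l = real n" by (simp add: n_def)
    have "(1 - e n) * (real n / 2) = (real n - 3) / 2" using n by (simp add: e_def field_simps)
    then show ?lower
      using f_par_lower[of k l n] n unfolding real_n by (simp add: n_def)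
    have "(1 + d n) * real n = real n + log 2 90 + 8 * log 2 (real n)"
      using n by (simp add: d_def log_def field_simps)
    also have "8 * log 2 (real n) = log 2 (real n ^ 8)" using n by (simp add: log_nat_power)
    finally have "2 powr ((1 + d n) * real n) = 2 powr real n * 90 * real n ^ 8"
      using n by (simp add: powr_add powr_log_cancel)
    also have "\<dots> \<ge> 1 * 90 * real n ^ 8"
      by (intro mult_right_mono) (simp_all add: ge_one_powr_ge_zero)
    finally have "real (90 * n ^ 8) \<le> 2 powr ((1 + d n) * real n)" by simp
    then have "2 powr real (90 * n ^ 8) \<le> 2 powr (2 powr ((1 + d n) * real n))"
      by (intro powr_mono) auto
    moreover have "2 powr real (90 * n ^ 8) = real (2 ^ (90 * n ^ 8))"
      by (simp only: powr_realpow zero_less_numeral of_nat_power of_nat_numeral)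
    ultimately have "real (2 ^ (90 * n ^ 8)) \<le> 2 powr (2 powr ((1 + d n) * real n))" by (simp only:)
    then have "ereal_of_enat (enat (2 ^ (90 * n ^ 8))) \<le> ereal (2 powr (2 powr ((1 + d n) * real n)))"
      by (simp only: ereal_of_enat_simps ereal_less_eq)
    moreover have "ereal_of_enat (f_par S_aleph0 k l) \<le> ereal_of_enat (enat (2 ^ (90 * n ^ 8)))"
      unfolding ereal_of_enat_le_iff by (rule f_par_upper) (use kl in \<open>simp_all add: n_def\<close>)
    ultimately show ?upper unfolding real_n n_def[symmetric] by (rule order_trans[rotated])
  qed
  ultimately show ?thesis
    by (intro exI[of _ "\<lambda>k l. e (k * l)"] exI[of _ "\<lambda>k l. d (k * l)"] conjI allI impI
      tendsto_filtercomap_mult) auto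
qed

end
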